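(* Let $f_1,\dots,f_m:\mathbb{R}^d\to\mathbb{R}$ each be $\mu$-strongly convex and $L$-smooth with $\mu>0$, let $\kappa=L/\mu$, let $G:\mathbb{R}^d\to\mathbb{R}\cup\{\pm\infty\}$ be proper, closed and convex, and let $x^\star$ be the optimal solution of $\min_{x\in\mathbb{R}^d}\frac1m\sum_{i=1}^m f_i(x)+G(x)$. Let $A\in\mathbb{R}^{m\times m}$, $B,C\in\mathbb{S}^m$ and $\gamma$ satisfy: (i) $A=BD$ with $D\in\mathbb{S}^m$, $0\prec D\preceq I$; (ii) $1^\top D1=m$ and $1^\top B=1^\top$; (iii) $0\preceq C\prec I$ and $\mathrm{Null}(C)=\mathrm{span}(1)$; (iv) $B$ and $C$ commute; (v) $q(D,\gamma)^2B^2\prec I-C$ and $0<\gamma\le\gamma^\star(D)$, where $$\gamma^\star(D)=\frac{2\lambda_{\min}(D)}{L+\mu\lambda_{\min}(D)},\qquad q(D,\gamma)=\sqrt{1-\frac{2\gamma L}{\kappa+\lambda_{\min}(D)}}.$$ Let $Z^0\in\mathbb{R}^{m\times d}$ be arbitrary, $Y^0=0$, and for $k\ge0$ $$X^k=\mathrm{prox}_{\gamma g}(Z^k),\qquad Z^{k+1}=AX^k-\gamma B\nabla f(X^k)-Y^k,\qquad Y^{k+1}=Y^k+CZ^{k+1}.$$ Then $\|X^k-1x^{\star\top}\|^2=\mathcal{O}(\delta^k)$ with $$\delta=\max\Big(q(D,\gamma)^2\,\lambda_{\max}\big(B^2(I-C)^{-1}\big),\;1-\lambda_2(C)\Big).$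$
   Context: $\mathbb{S}^m$ is the set of real symmetric $m\times m$ matrices; $\preceq,\prec$ denote the Loewner order. $1\in\mathbb{R}^m$ is the all-ones vector. For $X=[x_1,\dots,x_m]^\top\in\mathbb{R}^{m\times d}$ (row $i$ is $x_i^\top$), $f(X)=\sum_{i=1}^m f_i(x_i)$, $g(X)=\sum_{i=1}^m G(x_i)$, $\nabla f(X)=[\nabla f_1(x_1),\dots,\nabla f_m(x_m)]^\top$, and $\mathrm{prox}_{\gamma g}(X)=\arg\min_{Y\in\mathbb{R}^{m\times d}} g(Y)+\frac1{2\gamma}\|X-Y\|^2$. "$L$-smooth" means differentiable with $L$-Lipschitz gradient. $\|\cdot\|$ is the Frobenius norm. $\lambda_{\min},\lambda_{\max}$ are the smallest and largest eigenvalues and $\lambda_2(C)$ is the second smallest eigenvalue of $C$. *)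

theory Defs
  imports "HOL-Analysis.Analysis" "HOL-Library.Landau_Symbols"
begin

definition strongly_convex :: "real \<Rightarrow> ('a::real_inner \<Rightarrow> real) \<Rightarrow> bool" where
  "strongly_convex \<mu> f \<longleftrightarrow> convex_on UNIV (\<lambda>x. f x - \<mu> / 2 * (norm x)\<^sup>2)"

definition grad :: "('a::real_inner \<Rightarrow> real) \<Rightarrow> 'a \<Rightarrow> 'a" where
  "grad f x = (THE D. GDERIV f x :> D)"

definition L_smooth :: "real \<Rightarrow> ('a::real_inner \<Rightarrow> real) \<Rightarrow> bool" where
  "L_smooth L f \<longleftrightarrow> (\<forall>x. f differentiable (at x)) \<and> L-lipschitz_on UNIV (grad f)"

definition ereal_epigraph :: "('a \<Rightarrow> ereal) \<Rightarrow> ('a \<times> real) set" where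
  "ereal_epigraph G = {(x, r). G x \<le> ereal r}"

definition proper_fun :: "('a \<Rightarrow> ereal) \<Rightarrow> bool" where
  "proper_fun G \<longleftrightarrow> (\<forall>x. G x \<noteq> -\<infinity>) \<and> (\<exists>x. G x \<noteq> \<infinity>)"

definition closed_fun :: "('a::topological_space \<Rightarrow> ereal) \<Rightarrow> bool" where
  "closed_fun G \<longleftrightarrow> closed (ereal_epigraph G)"

definition convex_fun :: "('a::real_vector \<Rightarrow> ereal) \<Rightarrow> bool" where
  "convex_fun G \<longleftrightarrow> convex (ereal_epigraph G)"

definition prox :: "real \<Rightarrow> ('a::real_normed_vector \<Rightarrow> ereal) \<Rightarrow> 'a \<Rightarrow> 'a" where
  "prox \<gamma> g X = arg_min (\<lambda>Y. g Y + ereal (1 / (2 * \<gamma>) * (norm (X - Y))\<^sup>2)) (\<lambda>_. True)"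

text \<open>
  An \<open>m \<times> d\<close> matrix is an element \<open>X\<close> of \<^typ>\<open>real ^ 'd ^ 'm\<close>, with rows \<open>X $ i\<close>.
  The norm of this type is the Euclidean norm of the vector of row norms, that is, the
  Frobenius norm.
\<close>

definition row_sum :: "('a \<Rightarrow> ereal) \<Rightarrow> 'a ^ 'm \<Rightarrow> ereal" where
  "row_sum G X = (\<Sum>i\<in>UNIV. G (X $ i))"

definition row_grad :: "('m \<Rightarrow> 'a::real_inner \<Rightarrow> real) \<Rightarrow> 'a ^ 'm \<Rightarrow> 'a ^ 'm" where
  "row_grad f X = (\<chi> i. grad (f i) (X $ i))"

definition symmetric_matrix :: "real ^ 'n ^ 'n \<Rightarrow> bool" where
  "symmetric_matrix A \<longleftrightarrow> transpose A = A"

definition loewner_le :: "real ^ 'n ^ 'n \<Rightarrow> real ^ 'n ^ 'n \<Rightarrow> bool" (infix \<open>\<preceq>\<^sub>L\<close> 50) where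
  "A \<preceq>\<^sub>L B \<longleftrightarrow> (\<forall>v. 0 \<le> v \<bullet> ((B - A) *v v))"

definition loewner_less :: "real ^ 'n ^ 'n \<Rightarrow> real ^ 'n ^ 'n \<Rightarrow> bool" (infix \<open>\<prec>\<^sub>L\<close> 50) where
  "A \<prec>\<^sub>L B \<longleftrightarrow> (\<forall>v. v \<noteq> 0 \<longrightarrow> 0 < v \<bullet> ((B - A) *v v))"

definition eigenspace :: "real ^ 'n ^ 'n \<Rightarrow> real \<Rightarrow> (real ^ 'n) set" where
  "eigenspace A l = {v. A *v v = l *\<^sub>R v}"

definition eigenvalues :: "real ^ 'n ^ 'n \<Rightarrow> real set" where
  "eigenvalues A = {l. \<exists>v. v \<noteq> 0 \<and> A *v v = l *\<^sub>R v}"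

definition lambda_min :: "real ^ 'n ^ 'n \<Rightarrow> real" where
  "lambda_min A = Min (eigenvalues A)"

definition lambda_max :: "real ^ 'n ^ 'n \<Rightarrow> real" where
  "lambda_max A = Max (eigenvalues A)"

text \<open>
  The eigenvalues in increasing order, each repeated according to its geometric multiplicity;
  for a symmetric matrix this is also the algebraic multiplicity, and the list has length
  \<^term>\<open>CARD('n)\<close>. Hence index 1 is the second smallest eigenvalue.
\<close>

definition sorted_eigenvalues :: "real ^ 'n ^ 'n \<Rightarrow> real list" where
  "sorted_eigenvalues A =
     concat (map (\<lambda>l. replicate (dim (eigenspace A l)) l) (sorted_list_of_set (eigenvalues A)))"

definition lambda_2 :: "real ^ 'n ^ 'n \<Rightarrow> real" where
  "lambda_2 A = sorted_eigenvalues A ! 1"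

definition gamma_star :: "real \<Rightarrow> real \<Rightarrow> real ^ 'n ^ 'n \<Rightarrow> real" where
  "gamma_star L \<mu> D = 2 * lambda_min D / (L + \<mu> * lambda_min D)"

definition q_factor :: "real \<Rightarrow> real \<Rightarrow> real ^ 'n ^ 'n \<Rightarrow> real \<Rightarrow> real" where
  "q_factor L \<mu> D \<gamma> = (let \<kappa> = L / \<mu> in sqrt (1 - 2 * \<gamma> * L / (\<kappa> + lambda_min D)))"

end

theory Submission
  imports Defs
begin

text \<open>
  Optimality of \<open>xstar\<close> gives a subgradient \<open>s\<close> of \<open>G\<close> there, hence a fixed point
  \<open>(Xs, Zs, Ys)\<close> of the iteration whose \<open>Zs\<close> has constant rows, so \<open>C Zs = 0\<close>, and whose \<open>Ys\<close>
  has columns orthogonal to the all-ones vector, so \<open>Ys = C Ts\<close>. The errors then obey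
  \<open>Z\<^sup>+ = B W - C T\<close> and \<open>T\<^sup>+ = T + Z\<^sup>+\<close>, where
  \<open>W = D (X - Xs) - \<gamma> (\<nabla>f(X) - \<nabla>f(Xs))\<close>. As \<open>B\<close>, \<open>C\<close> and \<open>R = (I - C)\<^sup>-\<^sup>1\<close> commute,
  \<open>|Z\<^sup>+|\<^sup>2 + \<langle>T\<^sup>+, R C T\<^sup>+\<rangle> = \<langle>B W, R B W\<rangle> + \<langle>T, C T\<rangle>\<close>.
  The last term is at most \<open>(1 - \<lambda>\<^sub>2(C)) \<langle>T, R C T\<rangle>\<close>, and the first is at most
  \<open>\<lambda>\<^sub>m\<^sub>a\<^sub>x(B\<^sup>2 R) |W|\<^sup>2\<close> with \<open>|W| \<le> (1 - \<gamma> \<mu>) |X - Xs| \<le> q |Z|\<close>, so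
  \<open>|Z|\<^sup>2 + \<langle>T, R C T\<rangle>\<close> contracts by the factor \<open>\<delta>\<close>.
\<close>

section \<open>Symmetric matrices and their extreme eigenvalues\<close>

lemma matrix_diff_ldistrib:
  fixes A :: "'a::ring_1 ^ 'n ^ 'm" and B C :: "'a ^ 'p ^ 'n"
  shows "A ** (B - C) = A ** B - A ** C"
  by (simp add: matrix_matrix_mult_def vec_eq_iff right_diff_distrib sum_subtractf)

lemma matrix_diff_rdistrib:
  fixes A B :: "'a::ring_1 ^ 'n ^ 'm" and C :: "'a ^ 'p ^ 'n"
  shows "(A - B) ** C = A ** C - B ** C"
  by (simp add: matrix_matrix_mult_def vec_eq_iff left_diff_distrib sum_subtractf)

lemma matrix_mult_scaleR:
  fixes A :: "real ^ 'n ^ 'm" and B :: "real ^ 'p ^ 'n"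
  shows "A ** (c *\<^sub>R B) = c *\<^sub>R (A ** B)" and "(c *\<^sub>R A) ** B = c *\<^sub>R (A ** B)"
  by (simp_all add: matrix_matrix_mult_def vec_eq_iff sum_distrib_left mult_ac)

lemma symmetric_matrix_inner:
  "symmetric_matrix A \<Longrightarrow> (A *v x) \<bullet> y = x \<bullet> (A *v y)"
  unfolding symmetric_matrix_def by (metis dot_lmul_matrix vector_transpose_matrix)

lemma symmetric_matrix_diff:
  "symmetric_matrix A \<Longrightarrow> symmetric_matrix B \<Longrightarrow> symmetric_matrix (A - B)"
  by (simp add: symmetric_matrix_def transpose_def vec_eq_iff)

lemma symmetric_matrix_scaleR: "symmetric_matrix A \<Longrightarrow> symmetric_matrix (c *\<^sub>R A)"
  by (simp add: symmetric_matrix_def transpose_def vec_eq_iff)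

lemma symmetric_matrix_mat: "symmetric_matrix (mat c)"
  by (simp add: symmetric_matrix_def)

lemma symmetric_matrix_mult:
  "symmetric_matrix A \<Longrightarrow> symmetric_matrix B \<Longrightarrow> A ** B = B ** A \<Longrightarrow> symmetric_matrix (A ** B)"
  by (simp add: symmetric_matrix_def matrix_transpose_mul)

text \<open>Left multiplication acts on each column separately, so this splitting carries symmetry
  and semidefiniteness from vectors over to matrix-valued iterates.\<close>

lemma row_inner_sum_columns:
  fixes X Y :: "real ^ 'd ^ 'm"
  shows "X \<bullet> Y = (\<Sum>j\<in>UNIV. column j X \<bullet> column j Y)"
  unfolding inner_vec_def column_def by (simp add: sum.swap[where A="UNIV :: 'm set"])

lemma column_matrix_mult:
  fixes A :: "real ^ 'n ^ 'm" and X :: "real ^ 'd ^ 'n"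
  shows "column j (A ** X) = A *v column j X"
  by (simp add: column_def matrix_matrix_mult_def matrix_vector_mult_def vec_eq_iff)

lemma symmetric_matrix_inner_matrix:
  fixes X Y :: "real ^ 'd ^ 'm"
  shows "symmetric_matrix A \<Longrightarrow> (A ** X) \<bullet> Y = X \<bullet> (A ** Y)"
  by (simp add: row_inner_sum_columns column_matrix_mult symmetric_matrix_inner)

lemma psd_inner_matrix:
  fixes X :: "real ^ 'd ^ 'm"
  assumes "\<And>v. 0 \<le> v \<bullet> (M *v v)"
  shows "0 \<le> X \<bullet> (M ** X)"
  using assms by (simp add: row_inner_sum_columns column_matrix_mult sum_nonneg)

text \<open>The eigenvector is a minimiser of the Rayleigh quotient on the unit sphere of the subspace.\<close>

lemma symmetric_matrix_invariant_subspace_eigenvector: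
  assumes sym: "symmetric_matrix M" and S: "subspace S" "S \<noteq> {0}"
    and inv: "\<And>v. v \<in> S \<Longrightarrow> M *v v \<in> S"
  obtains v l where "v \<in> S" "v \<noteq> 0" "M *v v = l *\<^sub>R v"
    "\<And>w. w \<in> S \<Longrightarrow> l * (w \<bullet> w) \<le> w \<bullet> (M *v w)"
proof -
  define K where "K = S \<inter> sphere 0 1"
  have "compact K"
    unfolding K_def by (intro closed_Int_compact closed_subspace S compact_sphere)
  moreover have "K \<noteq> {}"
  proof -
    obtain x where x: "x \<in> S" "x \<noteq> 0" using S subspace_0 by blast
    then have "(1 / norm x) *\<^sub>R x \<in> K"
      using S by (simp add: K_def subspace_scale)
    then show ?thesis by blast
  qed
  moreover have "continuous_on K (\<lambda>w. w \<bullet> (M *v w))"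
    by (intro continuous_intros linear_continuous_on matrix_vector_mul_bounded_linear)
  ultimately obtain v where v: "v \<in> K" and vmin: "\<And>w. w \<in> K \<Longrightarrow> v \<bullet> (M *v v) \<le> w \<bullet> (M *v w)"
    using continuous_attains_inf by metis
  define l where "l = v \<bullet> (M *v v)"
  have vv: "v \<in> S" "v \<bullet> v = 1" "v \<noteq> 0" using v by (auto simp: K_def norm_eq_1)
  have ray: "l * (w \<bullet> w) \<le> w \<bullet> (M *v w)" if "w \<in> S" for w
  proof (cases "w = 0")
    case False
    define u where "u = (1 / norm w) *\<^sub>R w"
    have "u \<in> K" using False that S by (simp add: K_def u_def subspace_scale)
    then have "l \<le> u \<bullet> (M *v u)" using vmin l_def by blast
    also have "\<dots> = (w \<bullet> (M *v w)) / (w \<bullet> w)"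
      by (simp add: u_def matrix_vector_mult_scaleR dot_square_norm power2_eq_square)
    finally show ?thesis using False by (simp add: field_simps)
  qed simp
  define u where "u = M *v v - l *\<^sub>R v"
  have uS: "u \<in> S" unfolding u_def using vv inv S by (simp add: subspace_diff subspace_scale)
  define c where "c = u \<bullet> (M *v u) - l * (u \<bullet> u)"
  have c: "c \<ge> 0" using ray[OF uS] by (simp add: c_def)
  \<comment> \<open>Perturb \<open>v\<close> against the residual \<open>u\<close>: the constant
    term vanishes by the choice of \<open>l\<close>, the linear term is
    \<open>- 2 * s * (u \<bullet> u)\<close>, and minimality at \<open>v\<close> keeps the whole
    expression nonnegative.\<close>
  have key: "2 * (u \<bullet> u) \<le> s * c" if "s > 0" for s
  proof -
    have "v - s *\<^sub>R u \<in> S" using vv uS S by (simp add: subspace_diff subspace_scale)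
    from ray[OF this]
    have "0 \<le> (v - s *\<^sub>R u) \<bullet> (M *v (v - s *\<^sub>R u)) - l * ((v - s *\<^sub>R u) \<bullet> (v - s *\<^sub>R u))" by simp
    also have "\<dots> = (v \<bullet> (M *v v) - l * (v \<bullet> v)) - s * (u \<bullet> (M *v v) + v \<bullet> (M *v u) - 2 * l * (u \<bullet> v)) + s * s * c"
      by (simp add: c_def matrix_vector_mult_diff_distrib matrix_vector_mult_scaleR inner_diff_left
          inner_diff_right inner_commute algebra_simps)
    also have "v \<bullet> (M *v u) = u \<bullet> (M *v v)"
      using symmetric_matrix_inner[OF sym] by (metis inner_commute)
    also have "u \<bullet> (M *v v) + u \<bullet> (M *v v) - 2 * l * (u \<bullet> v) = 2 * (u \<bullet> u)"
      by (simp add: u_def inner_diff_right inner_diff_left algebra_simps)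
    finally have "0 \<le> s * (s * c - 2 * (u \<bullet> u))" by (simp add: l_def vv algebra_simps)
    then show ?thesis using that by (simp add: zero_le_mult_iff)
  qed
  have "u \<bullet> u \<le> 0"
  proof (rule ccontr)
    assume "\<not> u \<bullet> u \<le> 0"
    then have p: "u \<bullet> u > 0" by (simp only: not_le)
    \<comment> \<open>This value of \<open>s\<close> makes \<open>s * c\<close> at most
      \<open>u \<bullet> u\<close>; the summand 1 covers \<open>c = 0\<close>.\<close>
    then have "2 * (u \<bullet> u) \<le> (u \<bullet> u) / (c + 1) * c" using key[of "(u \<bullet> u) / (c + 1)"] c by simp
    also have "\<dots> \<le> u \<bullet> u" using c p by (simp add: field_simps)
    finally show False using p by simp
  qed
  then have "u = 0" by (metis inner_gt_zero_iff not_le)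
  then have "M *v v = l *\<^sub>R v" by (simp add: u_def)
  then show ?thesis using that vv ray by blast
qed

text \<open>Instead of a simultaneous diagonalisation: the lowest eigenspace of \<open>M\<close> is invariant under
  \<open>C\<close>, so it contains an eigenvector of \<open>C\<close>.\<close>

lemma psd_if_common_eigenvalues_nonneg:
  fixes M C :: "real ^ 'n ^ 'n"
  assumes "symmetric_matrix M" "symmetric_matrix C" "M ** C = C ** M"
    and "\<And>u c l. u \<noteq> 0 \<Longrightarrow> C *v u = c *\<^sub>R u \<Longrightarrow> M *v u = l *\<^sub>R u \<Longrightarrow> 0 \<le> l"
  shows "0 \<le> v \<bullet> (M *v v)"
proof -
  have "(UNIV :: (real ^ 'n) set) \<noteq> {0}" using one_neq_zero by blast
  from symmetric_matrix_invariant_subspace_eigenvector[OF assms(1) subspace_UNIV this]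
  obtain v0 l where v0: "v0 \<noteq> 0" "M *v v0 = l *\<^sub>R v0"
    and ray: "\<And>w. l * (w \<bullet> w) \<le> w \<bullet> (M *v w)" by (metis UNIV_I)
  let ?S = "{w. M *v w = l *\<^sub>R w}"
  have sub: "subspace ?S"
    by (auto simp: subspace_def matrix_vector_right_distrib matrix_vector_mult_scaleR scaleR_add_right)
  have inv: "C *v w \<in> ?S" if "w \<in> ?S" for w
    using that assms(3) by (simp add: matrix_vector_mul_assoc) (metis matrix_vector_mul_assoc matrix_vector_mult_scaleR)
  have "?S \<noteq> {0}" using v0 by blast
  from symmetric_matrix_invariant_subspace_eigenvector[OF assms(2) sub this inv]
  obtain u c where "u \<in> ?S" "u \<noteq> 0" "C *v u = c *\<^sub>R u" by metis
  then have "0 \<le> l" using assms(4) by blast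
  then have "0 \<le> l * (v \<bullet> v)" by simp
  also have "\<dots> \<le> v \<bullet> (M *v v)" by (rule ray)
  finally show ?thesis .
qed

text \<open>Eigenvectors for distinct eigenvalues are orthogonal, so choosing one for each
  eigenvalue gives an independent, hence finite, family. Finiteness is what gives
  \<open>Min\<close>, \<open>Max\<close> and \<open>sorted_list_of_set\<close> their meaning
  here.\<close>

lemma finite_eigenvalues_symmetric:
  assumes sym: "symmetric_matrix A"
  shows "finite (eigenvalues A)"
proof -
  define e where "e l = (SOME v. v \<noteq> 0 \<and> A *v v = l *\<^sub>R v)" for l
  have e: "e l \<noteq> 0" "A *v e l = l *\<^sub>R e l" if "l \<in> eigenvalues A" for l
    using someI_ex[of "\<lambda>v. v \<noteq> 0 \<and> A *v v = l *\<^sub>R v"] that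
    by (auto simp: e_def eigenvalues_def)
  have orth: "e l \<bullet> e l' = 0" if "l \<in> eigenvalues A" "l' \<in> eigenvalues A" "l \<noteq> l'" for l l'
    using symmetric_matrix_inner[OF sym, of "e l" "e l'"] e that by simp
  have inj: "inj_on e (eigenvalues A)"
    by (rule inj_onI) (metis e(1) inner_eq_zero_iff orth)
  have "pairwise orthogonal (e ` eigenvalues A)"
    using orth by (auto simp: pairwise_def orthogonal_def)
  moreover have "0 \<notin> e ` eigenvalues A" using e by force
  ultimately have "independent (e ` eigenvalues A)" by (rule pairwise_orthogonal_independent)
  then have "finite (e ` eigenvalues A)" using independent_bound by blast
  then show ?thesis using inj finite_imageD by blast
qed

lemma eigenvalues_symmetric_nonempty:
  fixes A :: "real ^ 'n ^ 'n"
  assumes "symmetric_matrix A"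
  shows "eigenvalues A \<noteq> {}"
proof -
  have "(UNIV :: (real ^ 'n) set) \<noteq> {0}" using one_neq_zero by blast
  from symmetric_matrix_invariant_subspace_eigenvector[OF assms subspace_UNIV this]
  show ?thesis by (auto simp: eigenvalues_def) metis
qed

lemma lambda_min_eigenvalue: "symmetric_matrix A \<Longrightarrow> lambda_min A \<in> eigenvalues A"
  unfolding lambda_min_def
  by (intro Min_in finite_eigenvalues_symmetric eigenvalues_symmetric_nonempty)

lemma lambda_min_le: "symmetric_matrix A \<Longrightarrow> l \<in> eigenvalues A \<Longrightarrow> lambda_min A \<le> l"
  unfolding lambda_min_def by (intro Min_le finite_eigenvalues_symmetric)

lemma lambda_max_ge: "symmetric_matrix A \<Longrightarrow> l \<in> eigenvalues A \<Longrightarrow> l \<le> lambda_max A"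
  unfolding lambda_max_def by (intro Max_ge finite_eigenvalues_symmetric)

lemma lambda_max_rayleigh:
  assumes "symmetric_matrix A"
  shows "0 \<le> v \<bullet> ((lambda_max A *\<^sub>R mat 1 - A) *v v)"
proof (rule psd_if_common_eigenvalues_nonneg[where C = A])
  show "symmetric_matrix (lambda_max A *\<^sub>R mat 1 - A)"
    using assms by (intro symmetric_matrix_diff symmetric_matrix_scaleR symmetric_matrix_mat)
  show "(lambda_max A *\<^sub>R mat 1 - A) ** A = A ** (lambda_max A *\<^sub>R mat 1 - A)"
    by (simp add: matrix_diff_ldistrib matrix_diff_rdistrib matrix_mult_scaleR)
  fix u c l
  assume u: "u \<noteq> 0" "A *v u = c *\<^sub>R u" "(lambda_max A *\<^sub>R mat 1 - A) *v u = l *\<^sub>R u"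
  have "l *\<^sub>R u = (lambda_max A - c) *\<^sub>R u"
    using u(2,3) by (simp add: matrix_vector_mult_diff_rdistrib scaleR_matrix_vector_assoc[symmetric] scaleR_diff_left)
  then have "l = lambda_max A - c" using u(1) by simp
  moreover have "c \<le> lambda_max A" using assms u by (auto intro!: lambda_max_ge simp: eigenvalues_def)
  ultimately show "0 \<le> l" by simp
qed (rule assms)

text \<open>If 0 is a simple eigenvalue and the least one, it occupies exactly index 0 of the
  sorted list. For \<open>CARD('n) = 1\<close>, where \<open>lambda_2 C\<close> is unspecified, there is no nonzero eigenvalue.\<close>

lemma lambda_2_le_nonzero_eigenvalue:
  fixes C :: "real ^ 'n ^ 'n"
  assumes sym: "symmetric_matrix C" and psd: "0 \<preceq>\<^sub>L C" and null: "dim {v. C *v v = 0} = 1"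
    and c: "c \<in> eigenvalues C" "c \<noteq> 0"
  shows "lambda_2 C \<le> c"
proof -
  have nonneg: "0 \<le> l" if l: "l \<in> eigenvalues C" for l
  proof -
    obtain v where v: "v \<noteq> 0" "C *v v = l *\<^sub>R v" using l by (auto simp: eigenvalues_def)
    have "0 \<le> v \<bullet> ((C - 0) *v v)" using psd by (simp only: loewner_le_def)
    moreover have "0 < v \<bullet> v" using v by simp
    ultimately show ?thesis using v(2) by (simp add: zero_le_mult_iff del: inner_gt_zero_iff)
  qed
  define E where "E = sorted_list_of_set (eigenvalues C)"
  have fin: "finite (eigenvalues C)" using sym by (rule finite_eigenvalues_symmetric)
  have setE: "set E = eigenvalues C" and sE: "sorted E" and dE: "distinct E" using fin by (simp_all add: E_def)
  have 0: "0 \<in> eigenvalues C"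
  proof -
    have "{v. C *v v = 0} \<noteq> {0}" using null by (metis dim_singleton zero_neq_one dim_eq_0 subset_refl)
    moreover have "0 \<in> {v. C *v v = 0}" by simp
    ultimately obtain v where "v \<noteq> 0" "C *v v = 0" by blast
    then show ?thesis by (auto simp: eigenvalues_def)
  qed
  obtain a E' where E1: "E = a # E'" using 0 setE by (cases E) auto
  have "a = 0" using 0 nonneg sE unfolding setE[symmetric] E1 by (fastforce intro: antisym)
  moreover have "E' \<noteq> []" using c setE E1 \<open>a = 0\<close> by auto
  then obtain b E'' where "E' = b # E''" by (cases E') auto
  ultimately have E: "E = 0 # b # E''" using E1 by simp
  have b: "b \<in> eigenvalues C" using E setE by auto
  then obtain v where v: "v \<noteq> 0" "v \<in> eigenspace C b" by (auto simp: eigenvalues_def eigenspace_def)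
  \<comment> \<open>The block of copies of \<open>b\<close> must be nonempty for index 1 to fall
    into it.\<close>
  have "dim (eigenspace C b) \<noteq> 0"
    using v by (auto simp: dim_eq_0)
  then obtain n where n: "dim (eigenspace C b) = Suc n" by (metis not0_implies_Suc)
  have "dim (eigenspace C 0) = 1" using null by (simp add: eigenspace_def)
  then have "lambda_2 C = b"
    using n by (simp add: lambda_2_def sorted_eigenvalues_def E_def[symmetric] E)
  moreover have "c \<in> set (b # E'')" using c setE E by auto
  then have "b \<le> c" using sE E by auto
  ultimately show ?thesis by simp
qed

lemma matrix_inv_inverse:
  assumes "invertible A"
  shows "A ** matrix_inv A = mat 1" "matrix_inv A ** A = mat 1"
  using assms someI_ex[of "\<lambda>A'. A ** A' = mat 1 \<and> A' ** A = mat 1"]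
  unfolding invertible_def matrix_inv_def by auto

lemma invertible_if_positive_definite:
  fixes A :: "real ^ 'n ^ 'n"
  assumes "0 \<prec>\<^sub>L A"
  shows "invertible A"
proof -
  have "v = 0" if "A *v v = 0" for v
    using assms that unfolding loewner_less_def by (metis diff_0_right inner_zero_right less_irrefl)
  then show ?thesis
    by (simp add: invertible_left_inverse matrix_left_invertible_ker)
qed

section \<open>Smooth strongly convex functions\<close>

text \<open>\<open>grad\<close> is a definite description, so both existence and uniqueness of the
  gradient are needed. The adjoint of the derivative, evaluated at 1, represents it as an inner
  product.\<close>

lemma GDERIV_grad:
  fixes f :: "'a::euclidean_space \<Rightarrow> real"
  assumes "f differentiable (at x)"
  shows "GDERIV f x :> grad f x"
proof -
  obtain f' where f': "(f has_derivative f') (at x)" using assms by (auto simp: differentiable_def)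
  then have "linear f'" by (rule has_derivative_linear)
  then have "f' = (\<lambda>h. h \<bullet> adjoint f' 1)" by (simp add: adjoint_works)
  then have *: "GDERIV f x :> adjoint f' 1" using f' by (simp add: gderiv_def)
  moreover have "D = adjoint f' 1" if "GDERIV f x :> D" for D
  proof -
    have "(\<lambda>h. h \<bullet> D) = (\<lambda>h. h \<bullet> adjoint f' 1)"
      using has_derivative_unique that * unfolding gderiv_def by blast
    then show ?thesis by (metis inner_commute vector_eq_rdot)
  qed
  ultimately show ?thesis unfolding grad_def by (rule theI2)
qed

lemma GDERIV_line:
  assumes "GDERIV f (x + t *\<^sub>R d) :> D"
  shows "((\<lambda>t. f (x + t *\<^sub>R d)) has_real_derivative D \<bullet> d) (at t)"
proof -
  have "((\<lambda>t. x + t *\<^sub>R d) has_derivative (\<lambda>h. h *\<^sub>R d)) (at t)"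
    by (auto intro!: derivative_eq_intros)
  from has_derivative_compose[OF this assms[unfolded gderiv_def]]
  show ?thesis by (simp add: has_field_derivative_def inner_commute mult_commute_abs)
qed

lemma GDERIV_norm_square: "GDERIV (\<lambda>x. c / 2 * (norm (x - z))\<^sup>2) x :> c *\<^sub>R (x - z)"
  unfolding gderiv_def power2_norm_eq_inner
  by (auto intro!: derivative_eq_intros simp: inner_commute algebra_simps)

text \<open>A negative \<open>p + c\<close> would make \<open>a t + t * c\<close> strictly decrease
  to the right of 0. This one-sided test serves both the gradient inequality and the first-order
  optimality condition.\<close>

lemma directional_derivative_ge:
  fixes a :: "real \<Rightarrow> real"
  assumes a: "(a has_real_derivative p) (at 0)"
    and ge: "\<And>t. 0 < t \<Longrightarrow> t \<le> 1 \<Longrightarrow> a 0 \<le> a t + t * c"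
  shows "0 \<le> p + c"
proof (rule ccontr)
  assume "\<not> 0 \<le> p + c"
  moreover have "((\<lambda>t. a t + t * c) has_real_derivative p + c) (at 0)"
    using a by (auto intro!: derivative_eq_intros)
  ultimately obtain d where d: "d > 0" "\<And>h. 0 < h \<Longrightarrow> h < d \<Longrightarrow> a (0 + h) + (0 + h) * c < a 0 + 0 * c"
    using DERIV_neg_dec_right[of "\<lambda>t. a t + t * c" "p + c" 0] by (metis not_le)
  define t where "t = min (d / 2) 1"
  have "0 < t" "t < d" "t \<le> 1" using d(1) by (auto simp: t_def)
  then show False using d(2)[of t] ge[of t] by simp
qed

lemma convex_on_gradient_ineq:
  assumes "convex_on UNIV h" and D: "GDERIV h x :> D"
  shows "h x + D \<bullet> (y - x) \<le> h y"
proof -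
  \<comment> \<open>The sign is flipped because the test bounds a derivative from below, while
    convexity bounds the increments of \<open>h\<close> from above.\<close>
  let ?a = "\<lambda>t. - h (x + t *\<^sub>R (y - x))"
  have "(?a has_real_derivative - (D \<bullet> (y - x))) (at 0)"
    using D by (intro DERIV_minus GDERIV_line) simp
  moreover have "?a 0 \<le> ?a t + t * (h y - h x)" if "0 < t" "t \<le> 1" for t
  proof -
    have "h ((1 - t) *\<^sub>R x + t *\<^sub>R y) \<le> (1 - t) * h x + t * h y"
      using convex_onD[OF assms(1)] that by auto
    moreover have "(1 - t) *\<^sub>R x + t *\<^sub>R y = x + t *\<^sub>R (y - x)" by (simp add: algebra_simps)
    ultimately show ?thesis by (simp add: algebra_simps)
  qed
  ultimately have "0 \<le> - (D \<bullet> (y - x)) + (h y - h x)" by (rule directional_derivative_ge)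
  then show ?thesis by simp
qed

lemma descent_lemma:
  fixes f :: "'a::euclidean_space \<Rightarrow> real"
  assumes "L_smooth L f"
  shows "f y \<le> f x + grad f x \<bullet> (y - x) + L / 2 * (norm (y - x))\<^sup>2"
proof -
  have diff: "GDERIV f z :> grad f z" for z
    using assms by (simp add: L_smooth_def GDERIV_grad)
  have lip: "norm (grad f u - grad f v) \<le> L * norm (u - v)" for u v
    using assms unfolding L_smooth_def lipschitz_on_def dist_norm by blast
  define d where "d = y - x"
  \<comment> \<open>Along the segment, \<open>\<phi>\<close> is \<open>f\<close> minus its quadratic
    upper model, up to the constant \<open>f x\<close>. Cauchy-Schwarz and the Lipschitz bound make
    its derivative nonpositive.\<close>
  define \<phi> where "\<phi> t = f (x + t *\<^sub>R d) - t * (grad f x \<bullet> d) - L / 2 * t\<^sup>2 * (norm d)\<^sup>2" for t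
  have "\<phi> 1 \<le> \<phi> 0"
  proof (rule DERIV_nonpos_imp_nonincreasing[of 0 1 \<phi>])
    fix t :: real assume t: "0 \<le> t" "t \<le> 1"
    let ?e = "grad f (x + t *\<^sub>R d) - grad f x"
    have "(\<phi> has_real_derivative grad f (x + t *\<^sub>R d) \<bullet> d - grad f x \<bullet> d - L * t * (norm d)\<^sup>2) (at t)"
      unfolding \<phi>_def by (rule derivative_eq_intros GDERIV_line[OF diff] refl)+ simp
    moreover have "?e \<bullet> d \<le> norm ?e * norm d" by (rule norm_cauchy_schwarz)
    then have "?e \<bullet> d \<le> L * t * (norm d)\<^sup>2"
      using mult_right_mono[OF lip[of "x + t *\<^sub>R d" x] norm_ge_zero[of d]] t
      by (simp add: power2_eq_square mult_ac)
    then have "grad f (x + t *\<^sub>R d) \<bullet> d - grad f x \<bullet> d - L * t * (norm d)\<^sup>2 \<le> 0"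
      by (simp add: inner_diff_left)
    ultimately show "\<exists>z. (\<phi> has_real_derivative z) (at t) \<and> z \<le> 0" by blast
  qed simp
  then show ?thesis by (simp add: \<phi>_def d_def)
qed

text \<open>The lower bound from \<open>x\<close> and the upper bound from \<open>y\<close> are
  compared at a gradient-type step from \<open>y\<close>. Adding the result to the one with
  \<open>x\<close> and \<open>y\<close> exchanged cancels the values of \<open>h\<close>.\<close>

lemma cocoercive_if_quadratic_upper_bound:
  fixes g :: "'a::real_inner \<Rightarrow> 'a"
  assumes lower: "\<And>x y. h x + g x \<bullet> (y - x) \<le> h y"
    and upper: "\<And>x y. h y \<le> h x + g x \<bullet> (y - x) + M / 2 * (norm (y - x))\<^sup>2" and M: "M \<ge> 0"
  shows "(norm (g x - g y))\<^sup>2 \<le> M * ((g x - g y) \<bullet> (x - y))"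
proof -
  \<comment> \<open>\<open>M\<close> may be 0, as happens for \<open>L = \<mu>\<close>, so the step
    length \<open>1 / N\<close> uses a positive \<open>N \<ge> M\<close>.\<close>
  have half: "(norm (g y - g x))\<^sup>2 / (2 * N) \<le> h y - h x - g x \<bullet> (y - x)" if N: "N > 0" "N \<ge> M" for x y N
  proof -
    define e where "e = g y - g x"
    define z where "z = y - (1 / N) *\<^sub>R e"
    have "h x + g x \<bullet> (z - x) \<le> h z" by (rule lower)
    also have "\<dots> \<le> h y + g y \<bullet> (z - y) + M / 2 * (norm (z - y))\<^sup>2" by (rule upper)
    also have "\<dots> \<le> h y + g y \<bullet> (z - y) + N / 2 * (norm (z - y))\<^sup>2"
      using N by (intro add_left_mono mult_right_mono) auto
    also have "g y = g x + e" by (simp add: e_def)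
    also have "N / 2 * (norm (z - y))\<^sup>2 = (e \<bullet> e) / (2 * N)"
      using N by (simp add: z_def power_divide dot_square_norm) (simp add: power2_eq_square)
    also have "(g x + e) \<bullet> (z - y) = g x \<bullet> (z - y) - (e \<bullet> e) / N"
      by (simp add: z_def inner_add_left inner_diff_right add_divide_distrib)
    finally show ?thesis
      using N by (simp add: e_def[symmetric] power2_norm_eq_inner inner_diff_right field_simps)
  qed
  have pos: "(norm (g x - g y))\<^sup>2 \<le> N * ((g x - g y) \<bullet> (x - y))" if N: "N > 0" "N \<ge> M" for N
  proof -
    have "(norm (g y - g x))\<^sup>2 / (2 * N) + (norm (g x - g y))\<^sup>2 / (2 * N) \<le> (g x - g y) \<bullet> (x - y)"
      using add_mono[OF half[OF N, of y x] half[OF N, of x y]] by (simp add: inner_diff_left inner_diff_right)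
    then show ?thesis using N by (simp add: norm_minus_commute field_simps)
  qed
  show ?thesis
  proof (rule field_le_epsilon)
    \<comment> \<open>Now \<open>N\<close> approaches \<open>M\<close>. Taking
      \<open>N = M + 1\<close> gives \<open>?p \<ge> 0\<close>; then
      \<open>N = M + \<epsilon> / (?p + 1)\<close> exceeds the desired bound by at most
      \<open>\<epsilon>\<close>.\<close>
    fix \<epsilon> :: real assume \<epsilon>: "\<epsilon> > 0"
    let ?p = "(g x - g y) \<bullet> (x - y)"
    have "0 \<le> (M + 1) * ?p" using order_trans[OF zero_le_power2 pos[of "M + 1"]] M by simp
    then have p: "0 \<le> ?p" using M by (simp add: zero_le_mult_iff)
    have "(norm (g x - g y))\<^sup>2 \<le> (M + \<epsilon> / (?p + 1)) * ?p" using p M \<epsilon> by (intro pos) (simp_all add: add_nonneg_pos)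
    also have "\<dots> = M * ?p + \<epsilon> * (?p / (?p + 1))" by (simp add: algebra_simps)
    also have "\<epsilon> * (?p / (?p + 1)) \<le> \<epsilon> * 1" using p \<epsilon> by (intro mult_left_mono) simp_all
    finally show "(norm (g x - g y))\<^sup>2 \<le> M * ?p + \<epsilon>" by simp
  qed
qed

lemma strongly_convex_gradient_ineq:
  fixes f :: "'a::euclidean_space \<Rightarrow> real"
  assumes "strongly_convex \<mu> f" "f differentiable (at x)"
  shows "f x + grad f x \<bullet> (y - x) + \<mu> / 2 * (norm (y - x))\<^sup>2 \<le> f y"
proof -
  have "GDERIV (\<lambda>x. f x - \<mu> / 2 * (norm x)\<^sup>2) x :> grad f x - \<mu> *\<^sub>R x"
    using GDERIV_diff[OF GDERIV_grad[OF assms(2)] GDERIV_norm_square[of \<mu> 0]] by simp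
  from convex_on_gradient_ineq[OF assms(1)[unfolded strongly_convex_def] this, of y]
  show ?thesis by (simp add: power2_norm_eq_inner inner_diff_left inner_diff_right inner_commute algebra_simps)
qed

text \<open>At a unit vector the quadratic lower and upper models around 0 differ only in the
  coefficients \<open>\<mu> / 2\<close> and \<open>L / 2\<close>.\<close>

lemma strongly_convex_L_smooth_le:
  fixes f :: "'a::euclidean_space \<Rightarrow> real"
  assumes "strongly_convex \<mu> f" "L_smooth L f"
  shows "\<mu> \<le> L"
proof -
  obtain b :: 'a where b: "b \<in> Basis" by (meson ex_in_conv nonempty_Basis)
  have "f differentiable (at 0)" using assms(2) by (simp add: L_smooth_def)
  from strongly_convex_gradient_ineq[OF assms(1) this, of b] descent_lemma[OF assms(2), of b 0] b
  show ?thesis by simp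
qed

text \<open>Subtracting \<open>\<mu> / 2 * (norm x)\<^sup>2\<close> leaves a convex function with
  upper curvature \<open>L - \<mu>\<close>; cocoercivity of its gradient rearranges to this product.
  The same sector form is later proved for \<open>D\<close>, so both can be treated alike.\<close>

lemma gradient_difference_sector:
  fixes f :: "'a::euclidean_space \<Rightarrow> real"
  assumes sc: "strongly_convex \<mu> f" and sm: "L_smooth L f"
  defines "e \<equiv> \<lambda>x y. grad f x - grad f y"
  shows "0 \<le> (e x y - \<mu> *\<^sub>R (x - y)) \<bullet> (L *\<^sub>R (x - y) - e x y)"
proof -
  let ?h = "\<lambda>x. f x - \<mu> / 2 * (norm x)\<^sup>2" and ?g = "\<lambda>x. grad f x - \<mu> *\<^sub>R x"
  have lower: "?h x + ?g x \<bullet> (y - x) \<le> ?h y" for x y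
    using strongly_convex_gradient_ineq[OF sc, of x y] sm
    by (simp add: L_smooth_def power2_norm_eq_inner inner_diff_left inner_diff_right inner_commute algebra_simps)
  have upper: "?h y \<le> ?h x + ?g x \<bullet> (y - x) + (L - \<mu>) / 2 * (norm (y - x))\<^sup>2" for x y
    using descent_lemma[OF sm, of y x]
    by (simp add: power2_norm_eq_inner inner_diff_left inner_diff_right inner_commute algebra_simps)
      (simp add: field_simps)
  define u where "u = x - y"
  have "?g x - ?g y = e x y - \<mu> *\<^sub>R u" by (simp add: u_def e_def algebra_simps)
  then have "(norm (e x y - \<mu> *\<^sub>R u))\<^sup>2 \<le> (L - \<mu>) * ((e x y - \<mu> *\<^sub>R u) \<bullet> u)"
    using cocoercive_if_quadratic_upper_bound[of ?h ?g, OF lower upper, of x y]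
      strongly_convex_L_smooth_le[OF sc sm] u_def by simp
  then show ?thesis unfolding u_def[symmetric]
    by (simp add: power2_norm_eq_inner inner_diff_left inner_diff_right inner_commute algebra_simps)
qed

section \<open>Subgradients and the proximal operator\<close>

text \<open>Finiteness of \<open>G x\<close> is built in, so that subgradient inequalities at two
  points can be added in the reals.\<close>

definition subgradient :: "('a::real_inner \<Rightarrow> ereal) \<Rightarrow> 'a \<Rightarrow> 'a \<Rightarrow> bool" where
  "subgradient G x s \<longleftrightarrow> (\<exists>r. G x = ereal r \<and> (\<forall>y. ereal (r + s \<bullet> (y - x)) \<le> G y))"

text \<open>Compare \<open>x\<close> with points of the segment towards \<open>y\<close>: convexity
  of the epigraph bounds \<open>G\<close> there by linear interpolation, and the one-sided
  derivative test at \<open>x\<close> does the rest.\<close>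

lemma subgradient_if_composite_minimizer:
  assumes G: "proper_fun G" "convex_fun G" and D: "GDERIV F x :> D"
    and min: "is_arg_min (\<lambda>x. ereal (F x) + G x) (\<lambda>_. True) x"
  shows "subgradient G x (- D)"
proof -
  have ninf: "G y \<noteq> -\<infinity>" for y using G by (simp add: proper_fun_def)
  have le: "ereal (F x) + G x \<le> ereal (F y) + G y" for y
    using min by (auto simp: is_arg_min_def not_less)
  obtain y0 where "G y0 \<noteq> \<infinity>" using G by (auto simp: proper_fun_def)
  then have "G x \<noteq> \<infinity>" using le[of y0] by auto
  then obtain r where r: "G x = ereal r" using ninf[of x] by (cases "G x") auto
  have "ereal (r + - D \<bullet> (y - x)) \<le> G y" for y
  proof (cases "G y")
    case (real ry)
    let ?a = "\<lambda>t. F (x + t *\<^sub>R (y - x))"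
    have "(?a has_real_derivative D \<bullet> (y - x)) (at 0)" using D by (intro GDERIV_line) simp
    moreover have "?a 0 \<le> ?a t + t * (ry - r)" if t: "0 < t" "t \<le> 1" for t
    proof -
      have "(x, r) \<in> ereal_epigraph G" "(y, ry) \<in> ereal_epigraph G"
        using r real by (auto simp: ereal_epigraph_def)
      then have "(1 - t) *\<^sub>R (x, r) + t *\<^sub>R (y, ry) \<in> ereal_epigraph G"
        using G(2) t unfolding convex_fun_def by (intro convexD) auto
      moreover have "(1 - t) *\<^sub>R (x, r) + t *\<^sub>R (y, ry) = (x + t *\<^sub>R (y - x), r + t * (ry - r))"
        by (simp add: algebra_simps)
      ultimately have *: "G (x + t *\<^sub>R (y - x)) \<le> ereal (r + t * (ry - r))"
        by (simp add: ereal_epigraph_def)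
      have "ereal (F x + r) \<le> ereal (?a t) + G (x + t *\<^sub>R (y - x))" using le r by simp
      also have "\<dots> \<le> ereal (?a t) + ereal (r + t * (ry - r))" using * by (rule add_left_mono)
      finally show ?thesis by simp
    qed
    ultimately have "0 \<le> D \<bullet> (y - x) + (ry - r)" by (rule directional_derivative_ge)
    then show ?thesis using real by simp
  qed (use ninf in auto)
  then show ?thesis using r by (auto simp: subgradient_def)
qed

lemma subgradient_monotone:
  assumes "subgradient G x s" "subgradient G y t"
  shows "0 \<le> (s - t) \<bullet> (x - y)"
proof -
  obtain r where r: "G x = ereal r" "\<And>y. ereal (r + s \<bullet> (y - x)) \<le> G y" using assms by (auto simp: subgradient_def)
  obtain q where q: "G y = ereal q" "\<And>z. ereal (q + t \<bullet> (z - y)) \<le> G z" using assms by (auto simp: subgradient_def)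
  have "s \<bullet> (y - x) + t \<bullet> (x - y) \<le> 0" using r(2)[of y] q(2)[of x] r(1) q(1) by simp
  then show ?thesis by (simp add: inner_diff_left inner_diff_right)
qed

text \<open>The hypotheses are the optimality conditions of two proximal points. Monotonicity makes
  the difference \<open>d\<close> of the residuals form a nonnegative inner product with
  \<open>x - x'\<close>, so adding \<open>d\<close> cannot shorten \<open>x - x'\<close>.\<close>

lemma resolvent_nonexpansive:
  assumes \<gamma>: "\<gamma> > 0"
    and "subgradient G x ((1 / \<gamma>) *\<^sub>R (z - x))" "subgradient G x' ((1 / \<gamma>) *\<^sub>R (z' - x'))"
  shows "norm (x - x') \<le> norm (z - z')"
proof -
  define d where "d = z - z' - (x - x')"
  have "0 \<le> ((1 / \<gamma>) *\<^sub>R (z - x) - (1 / \<gamma>) *\<^sub>R (z' - x')) \<bullet> (x - x')"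
    by (rule subgradient_monotone[OF assms(2,3)])
  also have "(1 / \<gamma>) *\<^sub>R (z - x) - (1 / \<gamma>) *\<^sub>R (z' - x') = (1 / \<gamma>) *\<^sub>R d"
    by (simp add: d_def algebra_simps)
  finally have "0 \<le> d \<bullet> (x - x')" using \<gamma> by (simp add: zero_le_divide_iff)
  then have "(norm (x - x'))\<^sup>2 \<le> (norm (d + (x - x')))\<^sup>2"
    unfolding power2_norm_eq_inner inner_add_left inner_add_right
    using inner_ge_zero[of d] inner_commute[of d "x - x'"] by linarith
  then show ?thesis by (simp add: d_def)
qed

text \<open>The affine minorant given by one subgradient makes the proximal objective coercive.\<close>

lemma proximal_minimizer_exists:
  fixes G :: "'a::euclidean_space \<Rightarrow> ereal"
  assumes G: "closed_fun G" "proper_fun G" and sub: "subgradient G x0 s" and \<gamma>: "\<gamma> > 0"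
  shows "\<exists>w. is_arg_min (\<lambda>y. ereal (1 / \<gamma> / 2 * (norm (y - z))\<^sup>2) + G y) (\<lambda>_. True) w"
proof -
  obtain r0 where r0: "G x0 = ereal r0" "\<And>y. ereal (r0 + s \<bullet> (y - x0)) \<le> G y"
    using sub by (auto simp: subgradient_def)
  define \<Phi> where "\<Phi> p = snd p + 1 / \<gamma> / 2 * (norm (fst p - z))\<^sup>2" for p :: "'a \<times> real"
  \<comment> \<open>Minimising over pairs \<open>(y, r)\<close> trades a lower semicontinuous
    objective for the continuous \<open>\<Phi>\<close> on a closed set; \<open>K\<close> keeps the
    pairs that are no worse than \<open>(x0, r0)\<close>.\<close>
  define K where "K = ereal_epigraph G \<inter> {p. \<Phi> p \<le> \<Phi> (x0, r0)}"
  define c where "c = \<Phi> (x0, r0) - r0 - s \<bullet> (z - x0)"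
  \<comment> \<open>Chosen so that \<open>quad\<close> below fails for \<open>?u > R\<close>: as
    \<open>R \<ge> 1\<close>, the constant term is then dominated by its multiple with
    \<open>?u\<close>.\<close>
  define R where "R = 2 * \<gamma> * norm s + 2 * \<gamma> * \<bar>c\<bar> + 1"
  have cont: "continuous_on S \<Phi>" for S unfolding \<Phi>_def by (intro continuous_intros)
  have bound: "norm (y - z) \<le> R \<and> r \<in> {r0 - norm s * (R + norm (z - x0))..\<Phi> (x0, r0)}"
    if K: "(y, r) \<in> K" for y r
  proof -
    let ?u = "norm (y - z)"
    have "G y \<le> ereal r" using K by (simp add: K_def ereal_epigraph_def)
    from order_trans[OF r0(2) this] have lo: "r0 + s \<bullet> (y - x0) \<le> r" by simp
    have hi: "r + 1 / \<gamma> / 2 * ?u\<^sup>2 \<le> \<Phi> (x0, r0)" using K by (simp add: K_def \<Phi>_def)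
    have "s \<bullet> (y - x0) = s \<bullet> (y - z) + s \<bullet> (z - x0)" by (simp add: inner_diff_right)
    then have "1 / \<gamma> / 2 * ?u\<^sup>2 \<le> c - s \<bullet> (y - z)" using lo hi by (simp add: c_def)
    also have "\<dots> \<le> \<bar>c\<bar> + norm s * ?u" using Cauchy_Schwarz_ineq2[of s "y - z"] by simp
    finally have quad: "?u\<^sup>2 \<le> 2 * \<gamma> * \<bar>c\<bar> + 2 * \<gamma> * norm s * ?u" using \<gamma> by (simp add: field_simps)
    have "?u \<le> R"
    proof (rule ccontr)
      assume "\<not> ?u \<le> R"
      moreover have "1 \<le> R" using \<gamma> by (simp add: R_def)
      ultimately have "?u > R" "?u > 1" by simp_all
      then have "R * ?u < ?u * ?u" by (intro mult_strict_right_mono) linarith+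
      moreover have "2 * \<gamma> * \<bar>c\<bar> * 1 \<le> 2 * \<gamma> * \<bar>c\<bar> * ?u"
        using \<gamma> \<open>?u > 1\<close> by (intro mult_left_mono) auto
      ultimately show False using quad \<open>?u > 1\<close> by (simp add: R_def power2_eq_square algebra_simps)
    qed
    moreover have "norm (y - x0) \<le> R + norm (z - x0)"
      using norm_triangle_ineq[of "y - z" "z - x0"] \<open>?u \<le> R\<close> by simp
    then have "norm s * norm (y - x0) \<le> norm s * (R + norm (z - x0))" by (simp add: mult_left_mono)
    then have "r0 - norm s * (R + norm (z - x0)) \<le> r"
      using lo Cauchy_Schwarz_ineq2[of s "y - x0"] by simp
    moreover have "0 \<le> 1 / \<gamma> / 2 * ?u\<^sup>2" using \<gamma> by simp
    then have "r \<le> \<Phi> (x0, r0)" using hi by linarith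
    ultimately show ?thesis by simp
  qed
  have "p \<in> cball z R \<times> {r0 - norm s * (R + norm (z - x0))..\<Phi> (x0, r0)}" if "p \<in> K" for p
    using bound[of "fst p" "snd p"] that by (simp add: mem_Times_iff dist_norm norm_minus_commute)
  then have "K \<inter> (cball z R \<times> {r0 - norm s * (R + norm (z - x0))..\<Phi> (x0, r0)}) = K" by blast
  moreover have "compact (K \<inter> (cball z R \<times> {r0 - norm s * (R + norm (z - x0))..\<Phi> (x0, r0)}))"
  proof (rule closed_Int_compact)
    show "closed K"
      unfolding K_def using G(1) unfolding closed_fun_def
      by (intro closed_Int closed_Collect_le cont continuous_on_const)
  qed (intro compact_Times compact_cball compact_Icc)
  ultimately have "compact K" by simp
  have x0: "(x0, r0) \<in> K" using r0 by (simp add: K_def ereal_epigraph_def)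
  then have "K \<noteq> {}" by blast
  from continuous_attains_inf[OF \<open>compact K\<close> this cont]
  obtain p where p: "p \<in> K" "\<And>q. q \<in> K \<Longrightarrow> \<Phi> p \<le> \<Phi> q" by blast
  obtain w rw where w: "p = (w, rw)" by (rule prod.exhaust)
  have "\<not> ereal (1 / \<gamma> / 2 * (norm (y - z))\<^sup>2) + G y < ereal (1 / \<gamma> / 2 * (norm (w - z))\<^sup>2) + G w" for y
  proof
    assume lt: "ereal (1 / \<gamma> / 2 * (norm (y - z))\<^sup>2) + G y < ereal (1 / \<gamma> / 2 * (norm (w - z))\<^sup>2) + G w"
    also have "\<dots> \<le> ereal (1 / \<gamma> / 2 * (norm (w - z))\<^sup>2) + ereal rw"
      using p w by (intro add_left_mono) (simp add: K_def ereal_epigraph_def)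
    finally have lt: "ereal (1 / \<gamma> / 2 * (norm (y - z))\<^sup>2) + G y < ereal (\<Phi> p)"
      by (simp add: \<Phi>_def w add.commute)
    moreover have "G y \<noteq> -\<infinity>" using G(2) by (simp add: proper_fun_def)
    ultimately obtain ry where ry: "G y = ereal ry" by (cases "G y") auto
    then have "\<Phi> (y, ry) < \<Phi> p" using lt by (simp add: \<Phi>_def add.commute)
    moreover from this have "(y, ry) \<in> K"
      using ry p(2)[OF x0] by (simp add: K_def ereal_epigraph_def)
    then have "\<Phi> p \<le> \<Phi> (y, ry)" by (rule p(2))
    ultimately show False by linarith
  qed
  then show ?thesis unfolding is_arg_min_def by blast
qed

lemma resolvent_exists:
  fixes G :: "'a::euclidean_space \<Rightarrow> ereal"
  assumes G: "proper_fun G" "closed_fun G" "convex_fun G" and "subgradient G x0 s" and "\<gamma> > 0"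
  shows "\<exists>w. subgradient G w ((1 / \<gamma>) *\<^sub>R (z - w))"
proof -
  obtain w where w: "is_arg_min (\<lambda>y. ereal (1 / \<gamma> / 2 * (norm (y - z))\<^sup>2) + G y) (\<lambda>_. True) w"
    using proximal_minimizer_exists[OF G(2,1) assms(4,5)] by metis
  have "subgradient G w (- ((1 / \<gamma>) *\<^sub>R (w - z)))"
    by (rule subgradient_if_composite_minimizer[OF G(1,3) GDERIV_norm_square w])
  then show ?thesis by (metis minus_diff_eq scaleR_minus_right)
qed

text \<open>\<open>prox\<close> picks some minimiser, so identifying it needs uniqueness. Summing
  the row subgradient inequalities and completing the square shows that the objective at
  \<open>Y\<close> exceeds its value at \<open>W\<close> by at least
  \<open>1 / (2 * \<gamma>) * (norm (Y - W))\<^sup>2\<close>.\<close>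

lemma prox_row_sum_eqI:
  fixes G :: "'a::real_inner \<Rightarrow> ereal" and X W :: "'a ^ 'm"
  assumes \<gamma>: "\<gamma> > 0" and sub: "\<And>i. subgradient G (W $ i) ((1 / \<gamma>) *\<^sub>R (X $ i - W $ i))"
  shows "prox \<gamma> (row_sum G) X = W"
proof -
  let ?F = "\<lambda>Y. row_sum G Y + ereal (1 / (2 * \<gamma>) * (norm (X - Y))\<^sup>2)"
  obtain r where r: "\<And>i. G (W $ i) = ereal (r i)"
    "\<And>i y. ereal (r i + ((1 / \<gamma>) *\<^sub>R (X $ i - W $ i)) \<bullet> (y - W $ i)) \<le> G y"
    using sub unfolding subgradient_def by metis
  define m where "m = (\<Sum>i\<in>UNIV. r i) + 1 / (2 * \<gamma>) * (norm (X - W))\<^sup>2"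
  have FW: "?F W = ereal m" by (simp add: row_sum_def r m_def)
  have ge: "ereal (m + 1 / (2 * \<gamma>) * (norm (Y - W))\<^sup>2) \<le> ?F Y" for Y
  proof -
    have "(\<Sum>i\<in>UNIV. ereal (r i + ((1 / \<gamma>) *\<^sub>R (X $ i - W $ i)) \<bullet> (Y $ i - W $ i))) \<le> row_sum G Y"
      unfolding row_sum_def by (intro sum_mono r(2))
    also have "(\<Sum>i\<in>UNIV. ereal (r i + ((1 / \<gamma>) *\<^sub>R (X $ i - W $ i)) \<bullet> (Y $ i - W $ i)))
        = ereal ((\<Sum>i\<in>UNIV. r i) + 1 / \<gamma> * ((X - W) \<bullet> (Y - W)))"
      by (simp add: sum.distrib inner_vec_def sum_divide_distrib)
    finally have "ereal ((\<Sum>i\<in>UNIV. r i) + 1 / \<gamma> * ((X - W) \<bullet> (Y - W))) + ereal (1 / (2 * \<gamma>) * (norm (X - Y))\<^sup>2) \<le> ?F Y"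
      by (rule add_right_mono)
    moreover have "(norm (X - Y))\<^sup>2 = (norm (X - W))\<^sup>2 + (norm (Y - W))\<^sup>2 - 2 * ((X - W) \<bullet> (Y - W))"
      by (simp add: power2_norm_eq_inner inner_diff_left inner_diff_right inner_commute)
    then have "(\<Sum>i\<in>UNIV. r i) + 1 / \<gamma> * ((X - W) \<bullet> (Y - W)) + 1 / (2 * \<gamma>) * (norm (X - Y))\<^sup>2
        = m + 1 / (2 * \<gamma>) * (norm (Y - W))\<^sup>2"
      using \<gamma> by (simp add: m_def field_simps)
    ultimately show ?thesis by simp
  qed
  have "ereal m \<le> ?F Y" for Y
    using order_trans[OF _ ge[of Y], of "ereal m"] \<gamma> by simp
  then have "is_arg_min ?F (\<lambda>_. True) W" using FW by (simp add: is_arg_min_def not_less)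
  then have "is_arg_min ?F (\<lambda>_. True) (prox \<gamma> (row_sum G) X)"
    unfolding prox_def arg_min_def by (rule someI)
  then have "\<not> ?F W < ?F (prox \<gamma> (row_sum G) X)" unfolding is_arg_min_def by blast
  then have "?F (prox \<gamma> (row_sum G) X) \<le> ereal m" unfolding FW by (rule leI)
  from order_trans[OF ge this] have "1 / (2 * \<gamma>) * (norm (prox \<gamma> (row_sum G) X - W))\<^sup>2 \<le> 0" by simp
  then show ?thesis using \<gamma> by (simp add: mult_le_0_iff divide_le_0_iff)
qed

section \<open>Contraction of the error\<close>

text \<open>The hypothesis puts \<open>e\<close> in the ball with diameter from
  \<open>a *\<^sub>R x\<close> to \<open>b *\<^sub>R x\<close>: a nonnegative
  \<open>p \<bullet> q\<close> means that \<open>p - q\<close> is no longer than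
  \<open>p + q\<close>.\<close>

lemma sector_norm_bound:
  fixes x e :: "'a::real_inner"
  assumes sector: "0 \<le> (e - a *\<^sub>R x) \<bullet> (b *\<^sub>R x - e)" and "a \<le> b"
  shows "norm (e - ((a + b) / 2) *\<^sub>R x) \<le> (b - a) / 2 * norm x"
proof -
  define p where "p = e - a *\<^sub>R x"
  define q where "q = b *\<^sub>R x - e"
  have "(norm (p - q))\<^sup>2 \<le> (norm (p + q))\<^sup>2"
    using sector unfolding power2_norm_eq_inner p_def[symmetric] q_def[symmetric]
    by (simp add: inner_diff_left inner_diff_right inner_add_left inner_add_right inner_commute)
  then have "norm (p - q) \<le> norm (p + q)" by (rule power2_le_imp_le) simp
  also have "p + q = (b - a) *\<^sub>R x" by (simp add: p_def q_def scaleR_diff_left)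
  also have "p - q = 2 *\<^sub>R (e - ((a + b) / 2) *\<^sub>R x)"
  proof -
    have "a *\<^sub>R x + b *\<^sub>R x = 2 *\<^sub>R ((a + b) / 2) *\<^sub>R x" by (simp flip: scaleR_add_left)
    then show ?thesis by (simp add: p_def q_def scaleR_diff_right scaleR_2 algebra_simps)
  qed
  finally show ?thesis using \<open>a \<le> b\<close> by simp
qed

text \<open>Both \<open>d\<close> and \<open>e\<close> lie in balls centred on multiples of
  \<open>x\<close>. The step-size bound makes the difference \<open>?c\<close> of the centres'
  coefficients nonnegative, and \<open>?c\<close> plus the two radii is exactly
  \<open>1 - \<gamma> * \<mu>\<close>. No commutation between \<open>D\<close> and the gradient
  enters.\<close>

lemma gradient_step_contraction:
  fixes x d e :: "'a::real_inner"
  assumes d: "0 \<le> (d - l *\<^sub>R x) \<bullet> (1 *\<^sub>R x - d)" and e: "0 \<le> (e - \<mu> *\<^sub>R x) \<bullet> (L *\<^sub>R x - e)"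
    and "l \<le> 1" "\<mu> \<le> L" "0 \<le> \<gamma>" and \<gamma>: "\<gamma> * (L + \<mu>) \<le> 1 + l"
  shows "norm (d - \<gamma> *\<^sub>R e) \<le> (1 - \<gamma> * \<mu>) * norm x"
proof -
  let ?c = "(l + 1) / 2 - \<gamma> * ((\<mu> + L) / 2)"
  have c: "0 \<le> ?c" using \<gamma> by (simp add: algebra_simps)
  have "d - \<gamma> *\<^sub>R e = ?c *\<^sub>R x + (d - ((l + 1) / 2) *\<^sub>R x) - \<gamma> *\<^sub>R (e - ((\<mu> + L) / 2) *\<^sub>R x)"
    by (simp add: scaleR_diff_left scaleR_diff_right)
  also have "norm \<dots> \<le> norm (?c *\<^sub>R x) + norm (d - ((l + 1) / 2) *\<^sub>R x) + norm (\<gamma> *\<^sub>R (e - ((\<mu> + L) / 2) *\<^sub>R x))"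
    by (intro order_trans[OF norm_triangle_ineq4] add_right_mono norm_triangle_ineq)
  also have "\<dots> \<le> ?c * norm x + (1 - l) / 2 * norm x + \<gamma> * ((L - \<mu>) / 2 * norm x)"
    unfolding norm_scaleR
    using sector_norm_bound[OF d \<open>l \<le> 1\<close>] mult_left_mono[OF sector_norm_bound[OF e \<open>\<mu> \<le> L\<close>] \<open>0 \<le> \<gamma>\<close>] c \<open>0 \<le> \<gamma>\<close>
    by (intro add_mono) (simp_all only: abs_of_nonneg order_refl)
  also have "\<dots> = (1 - \<gamma> * \<mu>) * norm x" by (simp add: field_simps)
  finally show ?thesis .
qed

text \<open>The first bound rests on \<open>(1 + l) * (L + \<mu> * l) - 2 * l * (L + \<mu>) = (1 -
  l) * (L - \<mu> * l)\<close>. The second, with denominators cleared, is the step-size condition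
  multiplied by \<open>\<gamma> * \<mu>\<^sup>2\<close>.\<close>

lemma stepsize_bounds:
  fixes L \<mu> \<gamma> l :: real
  assumes "\<mu> > 0" "\<mu> \<le> L" "0 < l" "l \<le> 1" "0 < \<gamma>" "\<gamma> \<le> 2 * l / (L + \<mu> * l)"
  shows "\<gamma> * (L + \<mu>) \<le> 1 + l" and "(1 - \<gamma> * \<mu>)\<^sup>2 \<le> 1 - 2 * \<gamma> * L / (L / \<mu> + l)"
proof -
  have p: "L + \<mu> * l > 0" using assms by (simp add: add_pos_pos)
  then have g: "\<gamma> * (L + \<mu> * l) \<le> 2 * l" using assms by (simp add: field_simps)
  have "\<mu> * l \<le> L" using assms mult_left_mono[of l 1 \<mu>] by linarith
  then have "0 \<le> (1 - l) * (L - \<mu> * l)" using assms by simp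
  then have "2 * l * (L + \<mu>) \<le> (1 + l) * (L + \<mu> * l)" by (simp add: algebra_simps)
  moreover have "(\<gamma> * (L + \<mu> * l)) * (L + \<mu>) \<le> 2 * l * (L + \<mu>)"
    using g assms by (intro mult_right_mono) auto
  ultimately have "(\<gamma> * (L + \<mu>)) * (L + \<mu> * l) \<le> (1 + l) * (L + \<mu> * l)" by (simp add: mult_ac)
  then show "\<gamma> * (L + \<mu>) \<le> 1 + l" using p by simp
  have "(\<gamma> * \<mu> * \<mu>) * (\<gamma> * (L + \<mu> * l)) \<le> (\<gamma> * \<mu> * \<mu>) * (2 * l)" using g assms by (intro mult_left_mono) auto
  then have "2 * \<gamma> * L * \<mu> \<le> (1 - (1 - \<gamma> * \<mu>)\<^sup>2) * (L + \<mu> * l)"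
    by (simp add: power2_eq_square algebra_simps)
  then have "2 * \<gamma> * L * \<mu> / (L + \<mu> * l) \<le> 1 - (1 - \<gamma> * \<mu>)\<^sup>2" using p by (simp only: pos_divide_le_eq)
  moreover have "2 * \<gamma> * L / (L / \<mu> + l) = 2 * \<gamma> * L * \<mu> / (L + \<mu> * l)" using assms by (simp add: field_simps)
  ultimately show "(1 - \<gamma> * \<mu>)\<^sup>2 \<le> 1 - 2 * \<gamma> * L / (L / \<mu> + l)"
    by linarith
qed

section \<open>Spectral bounds for \<open>D\<close>\<close>

lemma lambda_min_bounds:
  assumes "symmetric_matrix D" "0 \<prec>\<^sub>L D" "D \<preceq>\<^sub>L mat 1"
  shows "0 < lambda_min D" "lambda_min D \<le> 1"
proof -
  obtain v where v: "v \<noteq> 0" "D *v v = lambda_min D *\<^sub>R v"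
    using lambda_min_eigenvalue[OF assms(1)] by (auto simp: eigenvalues_def)
  have vv: "0 < v \<bullet> v" using v by simp
  have "0 < v \<bullet> ((D - 0) *v v)" using v assms by (simp only: loewner_less_def) blast
  then show "0 < lambda_min D" using v(2) vv by (simp add: zero_less_mult_iff del: inner_gt_zero_iff)
  have "0 \<le> v \<bullet> ((mat 1 - D) *v v)" using assms by (simp only: loewner_le_def)
  also have "\<dots> = (1 - lambda_min D) * (v \<bullet> v)"
    using v(2) by (simp add: matrix_vector_mult_diff_rdistrib inner_diff_right algebra_simps)
  finally show "lambda_min D \<le> 1" using vv by (simp add: zero_le_mult_iff del: inner_gt_zero_iff)
qed

text \<open>The product \<open>(D - ?l *\<^sub>R mat 1) ** (mat 1 - D)\<close> is positive
  semidefinite, since an eigenvalue \<open>c\<close> of \<open>D\<close> turns it into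
  \<open>(c - ?l) * (1 - c)\<close>.\<close>

lemma lambda_min_sector:
  fixes X :: "real ^ 'd ^ 'm"
  assumes sym: "symmetric_matrix D" and le: "D \<preceq>\<^sub>L mat 1"
  shows "0 \<le> (D ** X - lambda_min D *\<^sub>R X) \<bullet> (1 *\<^sub>R X - D ** X)"
proof -
  let ?l = "lambda_min D"
  define M where "M = (D - ?l *\<^sub>R mat 1) ** (mat 1 - D)"
  have symE: "symmetric_matrix (D - ?l *\<^sub>R mat 1)"
    using sym by (intro symmetric_matrix_diff symmetric_matrix_scaleR symmetric_matrix_mat)
  have exp: "M = (1 + ?l) *\<^sub>R D - D ** D - ?l *\<^sub>R mat 1"
    by (simp add: M_def matrix_diff_ldistrib matrix_diff_rdistrib matrix_mult_scaleR algebra_simps)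
  have DD: "symmetric_matrix (D ** D)" using sym by (intro symmetric_matrix_mult) auto
  have "0 \<le> v \<bullet> (M *v v)" for v
  proof (rule psd_if_common_eigenvalues_nonneg[where C = D])
    show "symmetric_matrix M" unfolding exp
      using sym DD by (intro symmetric_matrix_diff symmetric_matrix_scaleR symmetric_matrix_mat)
    show "M ** D = D ** M"
      by (simp add: exp matrix_diff_ldistrib matrix_diff_rdistrib matrix_mult_scaleR matrix_mul_assoc)
    fix u c l assume u: "u \<noteq> 0" "D *v u = c *\<^sub>R u" "M *v u = l *\<^sub>R u"
    have "M *v u = ((1 + ?l) * c - c * c - ?l) *\<^sub>R u"
      by (simp add: exp matrix_vector_mult_diff_rdistrib scaleR_matrix_vector_assoc[symmetric] u(2)
          matrix_vector_mul_assoc[symmetric] matrix_vector_mult_scaleR scaleR_diff_left)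
    then have "l = (1 + ?l) * c - c * c - ?l" using u(1,3) by (metis scaleR_cancel_right)
    then have l: "l = (c - ?l) * (1 - c)" by (simp add: algebra_simps)
    have "?l \<le> c" using u by (intro lambda_min_le[OF sym]) (auto simp: eigenvalues_def)
    moreover have "0 \<le> u \<bullet> ((mat 1 - D) *v u)" using le by (simp only: loewner_le_def)
    then have "0 \<le> (1 - c) * (u \<bullet> u)"
      using u(2) by (simp add: matrix_vector_mult_diff_rdistrib inner_diff_right algebra_simps)
    moreover have "0 < u \<bullet> u" using u by simp
    ultimately show "0 \<le> l" unfolding l by (simp add: zero_le_mult_iff del: inner_gt_zero_iff)
  qed (rule sym)
  then have "0 \<le> X \<bullet> (M ** X)" by (rule psd_inner_matrix)
  also have "\<dots> = ((D - ?l *\<^sub>R mat 1) ** X) \<bullet> ((mat 1 - D) ** X)"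
    by (simp add: M_def symmetric_matrix_inner_matrix[OF symE] matrix_mul_assoc)
  finally show ?thesis by (simp add: matrix_diff_rdistrib matrix_mult_scaleR)
qed

text \<open>Adding the rank-one map onto \<open>a\<close> to \<open>C\<close> gives an injective,
  hence surjective, \<open>h\<close>. Since \<open>C\<close> maps into the complement of
  \<open>a\<close>, a preimage of \<open>v\<close> under \<open>h\<close> has no rank-one
  contribution.\<close>

lemma symmetric_matrix_range:
  fixes C :: "real ^ 'm ^ 'm"
  assumes sym: "symmetric_matrix C" and null: "{v. C *v v = 0} = span {a}" and av: "a \<bullet> v = 0"
  shows "\<exists>t. C *v t = v"
proof -
  define h where "h t = C *v t + (a \<bullet> t) *\<^sub>R a" for t
  have Ca: "C *v a = 0" using null span_base[of a "{a}"] by blast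
  have lin: "linear h"
    unfolding h_def by (rule linearI)
      (simp_all add: matrix_vector_right_distrib matrix_vector_mult_scaleR inner_add_right algebra_simps)
  have dot: "a \<bullet> h t = (a \<bullet> t) * (a \<bullet> a)" for t
    using symmetric_matrix_inner[OF sym, of a t] Ca by (simp add: h_def inner_add_right)
  \<comment> \<open>Stated for the product with \<open>a\<close>, this also covers
    \<open>a = 0\<close>.\<close>
  have zero: "(a \<bullet> t) *\<^sub>R a = 0" if "a \<bullet> h t = 0" for t using that dot[of t] by auto
  have "t = 0" if "h t = 0" for t
  proof -
    have at: "(a \<bullet> t) *\<^sub>R a = 0" using that by (intro zero) simp
    then have "C *v t = 0" using that unfolding h_def by (simp only: add_0_right)
    then obtain c where "t = c *\<^sub>R a" using null by (auto simp: span_singleton)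
    then show ?thesis using at by auto
  qed
  then have "inj h" by (simp add: linear_injective_0[OF lin])
  then have "surj h" using lin by (simp add: linear_injective_imp_surjective)
  then obtain t where t: "h t = v" by (metis surjD)
  then have "(a \<bullet> t) *\<^sub>R a = 0" using av by (intro zero) simp
  then have "C *v t = v" using t unfolding h_def by (simp only: add_0_right)
  then show ?thesis by blast
qed

lemma symmetric_matrix_range_columns:
  fixes C :: "real ^ 'm ^ 'm" and Y :: "real ^ 'd ^ 'm"
  assumes "symmetric_matrix C" "{v. C *v v = 0} = span {a}" "\<And>j. a \<bullet> column j Y = 0"
  shows "\<exists>T. C ** T = Y"
proof -
  obtain t where t: "\<And>j. C *v t j = column j Y" using symmetric_matrix_range[OF assms] by metis
  have "C ** (\<chi> i j. t j $ i) = Y"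
    using t by (simp add: vec_eq_iff matrix_matrix_mult_def matrix_vector_mult_def column_def)
  then show ?thesis by blast
qed

section \<open>Inverses and the energy balance\<close>

lemma matrix_inv_commute:
  fixes A :: "real ^ 'n ^ 'n"
  assumes "invertible A" "A ** B = B ** A"
  shows "matrix_inv A ** B = B ** matrix_inv A"
proof -
  let ?R = "matrix_inv A"
  have "?R ** B = ?R ** (B ** A) ** ?R"
    using matrix_inv_inverse[OF assms(1)] by (simp add: matrix_mul_assoc[symmetric])
  also have "\<dots> = ?R ** A ** B ** ?R" by (simp add: assms(2)[symmetric] matrix_mul_assoc)
  finally show ?thesis using matrix_inv_inverse[OF assms(1)] by simp
qed

lemma symmetric_matrix_inv:
  fixes A :: "real ^ 'n ^ 'n"
  assumes "invertible A" "symmetric_matrix A"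
  shows "symmetric_matrix (matrix_inv A)"
proof -
  let ?R = "matrix_inv A"
  have "transpose (A ** ?R) = mat 1" using matrix_inv_inverse[OF assms(1)] by simp
  then have "transpose ?R ** A = mat 1" using assms(2) by (simp add: matrix_transpose_mul symmetric_matrix_def)
  then have "transpose ?R ** A ** ?R = ?R" by simp
  then have "transpose ?R = ?R" using matrix_inv_inverse[OF assms(1)] by (simp add: matrix_mul_assoc[symmetric])
  then show ?thesis by (simp add: symmetric_matrix_def)
qed

text \<open>The dual error is \<open>C T\<close>; weighting \<open>T\<close> by \<open>(I - C)\<^sup>-\<^sup>1 C\<close> makes the energy
  balance an identity.\<close>

lemma lyapunov_step:
  fixes B C :: "real ^ 'm ^ 'm"
  defines "R \<equiv> matrix_inv (mat 1 - C)"
  assumes B: "symmetric_matrix B" and C: "symmetric_matrix C" "0 \<preceq>\<^sub>L C" "C \<prec>\<^sub>L mat 1"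
    and null: "dim {v. C *v v = 0} = 1" and comm: "B ** C = C ** B"
  shows "0 \<le> lambda_max (B ** B ** R)"
    and "0 \<le> (T :: real ^ 'd ^ 'm) \<bullet> (R ** C ** T)"
    and "(Z :: real ^ 'd ^ 'm) = B ** W - C ** T \<Longrightarrow>
      Z \<bullet> Z + (T + Z) \<bullet> (R ** C ** (T + Z))
        \<le> lambda_max (B ** B ** R) * (W \<bullet> W) + (1 - lambda_2 C) * (T \<bullet> (R ** C ** T))"
proof -
  define N where "N = R ** C"
  define P where "P = B ** B ** R"
  have inv: "invertible (mat 1 - C)"
    using C(3) by (intro invertible_if_positive_definite) (simp add: loewner_less_def)
  have symIC: "symmetric_matrix (mat 1 - C)" using C by (intro symmetric_matrix_diff symmetric_matrix_mat)
  have RI: "R ** (mat 1 - C) = mat 1" unfolding R_def by (rule matrix_inv_inverse[OF inv])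
  have symR: "symmetric_matrix R" unfolding R_def by (rule symmetric_matrix_inv[OF inv symIC])
  have RC: "R ** C = C ** R"
    unfolding R_def by (intro matrix_inv_commute inv) (simp add: matrix_diff_ldistrib matrix_diff_rdistrib)
  have RB: "R ** B = B ** R"
    unfolding R_def by (intro matrix_inv_commute inv) (simp add: matrix_diff_ldistrib matrix_diff_rdistrib comm)
  have symN: "symmetric_matrix N" unfolding N_def using symR C(1) RC by (rule symmetric_matrix_mult)
  have RN: "R = N + mat 1" using RI by (simp add: N_def matrix_diff_ldistrib algebra_simps)
  have NC: "N ** C = C ** N" by (metis N_def RC matrix_mul_assoc)
  have CN: "C ** N = N - C"
    unfolding NC[symmetric] using RN N_def by (metis RC add_diff_cancel_right' matrix_add_ldistrib matrix_mul_rid NC)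
  \<comment> \<open>On a common eigenvector \<open>N\<close> acts as \<open>c / (1 - c)\<close>; the
    quotient-free form suits the comparisons below.\<close>
  have eig: "c \<ge> 0 \<and> c < 1 \<and> (1 - c) * l = c" if u: "u \<noteq> 0" "C *v u = c *\<^sub>R u" "N *v u = l *\<^sub>R u" for u c l
  proof -
    have uu: "0 < u \<bullet> u" using u by simp
    have "0 \<le> u \<bullet> ((C - 0) *v u)" using C by (simp only: loewner_le_def)
    then have "0 \<le> c" using u(2) uu by (simp add: zero_le_mult_iff del: inner_gt_zero_iff)
    moreover have "0 < u \<bullet> ((mat 1 - C) *v u)" using C u by (simp only: loewner_less_def) blast
    then have "0 < (1 - c) * (u \<bullet> u)"
      using u(2) by (simp add: matrix_vector_mult_diff_rdistrib inner_diff_right algebra_simps)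
    then have "c < 1" using uu by (simp add: zero_less_mult_iff del: inner_gt_zero_iff)
    moreover have "C *v (N *v u) = N *v u - C *v u"
      using CN by (simp add: matrix_vector_mul_assoc matrix_vector_mult_diff_rdistrib)
    then have "(l * c) *\<^sub>R u = (l - c) *\<^sub>R u"
      using u by (simp add: matrix_vector_mult_scaleR scaleR_diff_left)
    then have "l * c = l - c" using u(1) by simp
    ultimately show ?thesis by (simp add: algebra_simps)
  qed
  have psdN: "0 \<le> v \<bullet> (N *v v)" for v
  proof (rule psd_if_common_eigenvalues_nonneg[OF symN C(1) NC])
    fix u c l assume "u \<noteq> 0" "C *v u = c *\<^sub>R u" "N *v u = l *\<^sub>R u"
    from eig[OF this] have "c \<ge> 0" "1 - c > 0" "(1 - c) * l = c" by auto
    then show "0 \<le> l" by (metis zero_le_mult_iff not_le)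
  qed
  \<comment> \<open>On a common eigenvector this amounts to
    \<open>c * (c - lambda_2 C) \<ge> 0\<close>, which holds because \<open>c\<close> is 0 or at
    least \<open>lambda_2 C\<close>.\<close>
  have gap: "0 \<le> v \<bullet> (((1 - lambda_2 C) *\<^sub>R N - C) *v v)" for v
  proof (rule psd_if_common_eigenvalues_nonneg[where C = N])
    show "symmetric_matrix ((1 - lambda_2 C) *\<^sub>R N - C)"
      using symN C(1) by (intro symmetric_matrix_diff symmetric_matrix_scaleR)
    show "((1 - lambda_2 C) *\<^sub>R N - C) ** N = N ** ((1 - lambda_2 C) *\<^sub>R N - C)"
      by (simp add: matrix_diff_ldistrib matrix_diff_rdistrib matrix_mult_scaleR NC)
    fix u l k assume u: "u \<noteq> 0" "N *v u = l *\<^sub>R u" "((1 - lambda_2 C) *\<^sub>R N - C) *v u = k *\<^sub>R u"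
    define c where "c = (1 - lambda_2 C) * l - k"
    have cu: "C *v u = c *\<^sub>R u"
      using u(2,3) by (simp add: c_def matrix_vector_mult_diff_rdistrib scaleR_matrix_vector_assoc[symmetric]
          scaleR_diff_left algebra_simps)
    from eig[OF u(1) cu u(2)] have c: "c \<ge> 0" "1 - c > 0" "(1 - c) * l = c" by auto
    have "c = 0 \<or> lambda_2 C \<le> c"
      using lambda_2_le_nonzero_eigenvalue[OF C(1,2) null] u(1) cu by (auto simp: eigenvalues_def)
    then have "0 \<le> c * (c - lambda_2 C)" using c by auto
    also have "\<dots> = (1 - lambda_2 C) * c - (1 - c) * c" by (simp add: algebra_simps)
    also have "\<dots> = (1 - lambda_2 C) * ((1 - c) * l) - (1 - c) * c" by (simp only: c(3))
    also have "\<dots> = (1 - c) * k" by (simp add: c_def algebra_simps)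
    finally show "0 \<le> k" using c(2) by (simp add: zero_le_mult_iff)
  qed (rule symN)
  show N0: "0 \<le> T \<bullet> (R ** C ** T)" unfolding N_def[symmetric] by (rule psd_inner_matrix[OF psdN])
  have symP: "symmetric_matrix P"
    unfolding P_def using B symR by (intro symmetric_matrix_mult) (auto simp: RB matrix_mul_assoc, metis RB matrix_mul_assoc)
  have PB: "P = B ** (R ** B)" by (simp add: P_def RB matrix_mul_assoc)
  have ray: "X \<bullet> (P ** X) \<le> lambda_max P * (X \<bullet> X)" for X :: "real ^ 'e ^ 'm"
    using psd_inner_matrix[OF lambda_max_rayleigh[OF symP], of X]
    by (simp add: matrix_diff_rdistrib matrix_mult_scaleR inner_diff_right)
  \<comment> \<open>\<open>R = N + mat 1\<close> is positive semidefinite, hence so is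
    \<open>P = B ** (R ** B)\<close>; one nonzero test vector then suffices.\<close>
  show "0 \<le> lambda_max (B ** B ** R)"
  proof -
    define v where "v = B *v (1 :: real ^ 'm)"
    have "0 \<le> v \<bullet> (N *v v) + v \<bullet> v" using psdN by simp
    also have "\<dots> = v \<bullet> (R *v v)" by (simp add: RN matrix_vector_mult_add_rdistrib inner_add_right)
    also have "\<dots> = 1 \<bullet> (P *v 1)"
      by (simp add: v_def PB symmetric_matrix_inner[OF B] matrix_vector_mul_assoc)
    also have "\<dots> \<le> lambda_max P * (1 \<bullet> (1 :: real ^ 'm))"
      using lambda_max_rayleigh[OF symP, of 1]
      by (simp add: matrix_vector_mult_diff_rdistrib scaleR_matrix_vector_assoc[symmetric] inner_diff_right)
    finally have "0 \<le> lambda_max P * (1 \<bullet> (1 :: real ^ 'm))" .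
    moreover have "0 < (1 \<bullet> (1 :: real ^ 'm))" by simp
    ultimately show ?thesis unfolding P_def by (simp add: zero_le_mult_iff del: inner_gt_zero_iff)
  qed
  assume Z: "Z = B ** W - C ** T"
  have 1: "Z \<bullet> (N ** T) = (N ** Z) \<bullet> T" by (simp add: symmetric_matrix_inner_matrix[OF symN])
  have 2: "(C ** T) \<bullet> (R ** Z) = (N ** T) \<bullet> Z"
    by (simp add: N_def symmetric_matrix_inner_matrix[OF symR, symmetric] matrix_mul_assoc)
  have 3: "(C ** T) \<bullet> (N ** T) = T \<bullet> (N ** T) - T \<bullet> (C ** T)"
    by (simp add: symmetric_matrix_inner_matrix[OF C(1)] matrix_mul_assoc CN matrix_diff_rdistrib inner_diff_right)
  have 4: "Z \<bullet> (R ** Z) = Z \<bullet> (N ** Z) + Z \<bullet> Z"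
    using matrix_diff_rdistrib[of R "mat 1" Z] RN by (simp add: inner_diff_right)
  have RCT: "R ** (C ** T) = N ** T" by (simp add: N_def matrix_mul_assoc)
  \<comment> \<open>Pair \<open>B ** W = Z + C ** T\<close> with its image under \<open>R\<close>:
    the identities 2 to 4 turn every term into \<open>N\<close>, \<open>C\<close> or the identity,
    and the \<open>N\<close> terms form the square at \<open>T + Z\<close>.\<close>
  have "(B ** W) \<bullet> (R ** (B ** W)) = (Z + C ** T) \<bullet> (R ** Z + N ** T)"
    by (simp add: Z matrix_diff_ldistrib RCT)
  also have "\<dots> = Z \<bullet> (N ** Z) + Z \<bullet> Z + (N ** T) \<bullet> Z + (Z \<bullet> (N ** T) + (T \<bullet> (N ** T) - T \<bullet> (C ** T)))"
    by (simp only: inner_add_left inner_add_right 2 3 4)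
  also have "\<dots> = Z \<bullet> Z + (T + Z) \<bullet> (N ** (T + Z)) - T \<bullet> (C ** T)"
    using 1 by (simp add: inner_add_left inner_add_right matrix_add_ldistrib inner_commute)
  finally have "Z \<bullet> Z + (T + Z) \<bullet> (N ** (T + Z)) = (B ** W) \<bullet> (R ** (B ** W)) + T \<bullet> (C ** T)" by simp
  also have "(B ** W) \<bullet> (R ** (B ** W)) = W \<bullet> (P ** W)"
    by (simp add: PB symmetric_matrix_inner_matrix[OF B] matrix_mul_assoc)
  also have "\<dots> + T \<bullet> (C ** T) \<le> lambda_max P * (W \<bullet> W) + (1 - lambda_2 C) * (T \<bullet> (N ** T))"
    using ray[of W] psd_inner_matrix[OF gap, of T]
    by (simp add: matrix_diff_rdistrib matrix_mult_scaleR inner_diff_right)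
  finally show "Z \<bullet> Z + (T + Z) \<bullet> (R ** C ** (T + Z))
      \<le> lambda_max (B ** B ** R) * (W \<bullet> W) + (1 - lambda_2 C) * (T \<bullet> (R ** C ** T))"
    by (simp add: N_def P_def)
qed

lemma GDERIV_average:
  fixes f :: "'m::finite \<Rightarrow> 'a::euclidean_space \<Rightarrow> real"
  assumes "\<And>i. f i differentiable (at x)"
  shows "GDERIV (\<lambda>x. c * (\<Sum>i\<in>UNIV. f i x)) x :> c *\<^sub>R (\<Sum>i\<in>UNIV. grad (f i) x)"
  using GDERIV_grad[OF assms] unfolding gderiv_def
  by (auto intro!: derivative_eq_intros simp: inner_sum_right)

lemma norm_le_rows:
  fixes X Y :: "'a::real_inner ^ 'm"
  assumes "\<And>i. norm (X $ i) \<le> norm (Y $ i)"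
  shows "norm X \<le> norm Y"
  unfolding norm_vec_def by (intro L2_set_mono assms norm_ge_zero)

theorem theorem18:
  fixes f :: "'m::finite \<Rightarrow> real ^ 'd::finite \<Rightarrow> real"
    and G :: "real ^ 'd \<Rightarrow> ereal"
    and A B C D :: "real ^ 'm ^ 'm"
    and X Y Z :: "nat \<Rightarrow> real ^ 'd ^ 'm"
    and xstar :: "real ^ 'd"
    and \<mu> L \<gamma> \<delta> :: real
  assumes "\<mu> > 0"
    and "\<And>i. strongly_convex \<mu> (f i)"
    and "\<And>i. L_smooth L (f i)"
    and "proper_fun G" and "closed_fun G" and "convex_fun G"
    and "is_arg_min (\<lambda>x. ereal (1 / real CARD('m) * (\<Sum>i\<in>UNIV. f i x)) + G x) (\<lambda>_. True) xstar"
    and "symmetric_matrix B" and "symmetric_matrix C"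
    and "A = B ** D" and "symmetric_matrix D" and "0 \<prec>\<^sub>L D" and "D \<preceq>\<^sub>L mat 1"
    and "1 \<bullet> (D *v 1) = real CARD('m)" and "1 v* B = 1"
    and "0 \<preceq>\<^sub>L C" and "C \<prec>\<^sub>L mat 1" and "{v. C *v v = 0} = span {1}"
    and "B ** C = C ** B"
    and "(q_factor L \<mu> D \<gamma>)\<^sup>2 *\<^sub>R (B ** B) \<prec>\<^sub>L mat 1 - C"
    and "0 < \<gamma>" and "\<gamma> \<le> gamma_star L \<mu> D"
    and "Y 0 = 0"
    and "\<And>k. X k = prox \<gamma> (row_sum G) (Z k)"
    and "\<And>k. Z (Suc k) = A ** X k - \<gamma> *\<^sub>R (B ** row_grad f (X k)) - Y k"
    and "\<And>k. Y (Suc k) = Y k + C ** Z (Suc k)"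
    and "\<delta> = max ((q_factor L \<mu> D \<gamma>)\<^sup>2 * lambda_max (B ** B ** matrix_inv (mat 1 - C)))
                 (1 - lambda_2 C)"
  shows "(\<lambda>k. (norm (X k - (\<chi> i. xstar)))\<^sup>2) \<in> O(\<lambda>k. \<delta> ^ k)"
proof -
  note \<mu> = assms(1) and sc = assms(2) and sm = assms(3) and G = assms(4-6) and \<gamma> = assms(21)
  define q where "q = q_factor L \<mu> D \<gamma>"
  define N where "N = matrix_inv (mat 1 - C) ** C"
  define lm where "lm = lambda_max (B ** B ** matrix_inv (mat 1 - C))"
  have \<delta>: "\<delta> = max (q\<^sup>2 * lm) (1 - lambda_2 C)" unfolding q_def lm_def by (rule assms(27))
  have null: "dim {v. C *v v = 0} = 1" unfolding assms(18) by (simp add: dim_singleton)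
  note lyapunov = lyapunov_step[OF assms(8,9,16,17) null assms(19), folded N_def lm_def]
  have \<delta>0: "0 \<le> \<delta>" using lyapunov(1) by (simp add: \<delta> le_max_iff_disj)

  \<comment> \<open>Consequences of the step-size condition\<close>
  have l: "0 < lambda_min D" "lambda_min D \<le> 1" using lambda_min_bounds assms(11-13) by auto
  have \<mu>L: "\<mu> \<le> L" using strongly_convex_L_smooth_le[OF sc sm] .
  note step = stepsize_bounds[OF \<mu> \<mu>L l \<gamma> assms(22)[unfolded gamma_star_def]]
  \<comment> \<open>The radicand of \<open>q_factor\<close> dominates a square, so it is nonnegative
    and squaring the root returns it.\<close>
  have q: "(1 - \<gamma> * \<mu>)\<^sup>2 \<le> q\<^sup>2"
    using step(2) order_trans[OF zero_le_power2 step(2)] by (simp add: q_def q_factor_def)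

  \<comment> \<open>Fixed point of the iteration\<close>
  define g where "g = row_grad f (\<chi> i. xstar)"
  define s where "s = - ((1 / real CARD('m)) *\<^sub>R (\<Sum>i\<in>UNIV. grad (f i) xstar))"
  define Xs :: "real ^ 'd ^ 'm" where "Xs = (\<chi> i. xstar)"
  \<comment> \<open>Shifting each row by \<open>\<gamma> *\<^sub>R s\<close> makes \<open>Xs\<close>
    the proximal point of \<open>Zs\<close>; \<open>Ys\<close> is then forced by the update of
    \<open>Z\<close>.\<close>
  define Zs :: "real ^ 'd ^ 'm" where "Zs = (\<chi> i. xstar + \<gamma> *\<^sub>R s)"
  define Ys where "Ys = A ** Xs - \<gamma> *\<^sub>R (B ** g) - Zs"
  have sub: "subgradient G xstar s" unfolding s_def
    using sm by (intro subgradient_if_composite_minimizer[OF G(1,3) GDERIV_average assms(7)]) (simp add: L_smooth_def)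
  have const: "column j (\<chi> i. x) = (x $ j) *\<^sub>R 1" for j and x :: "real ^ 'd"
    by (simp add: column_def vec_eq_iff)
  have "C *v 1 = 0" using assms(18) span_base[of 1 "{1}"] by blast
  then have "column j (C ** Zs) = 0" for j
    by (simp add: column_matrix_mult Zs_def const matrix_vector_mult_scaleR)
  then have CZs: "C ** Zs = 0" by (simp add: column_def vec_eq_iff)
  have dotB: "1 \<bullet> (B *v v) = 1 \<bullet> v" for v
    using dot_lmul_matrix[of 1 B v] assms(15) by simp
  \<comment> \<open>The column sums cancel: \<open>B\<close> preserves them, the total mass of
    \<open>D\<close> matches \<open>Xs\<close> against \<open>Zs\<close>, and \<open>s\<close> is
    minus the mean gradient.\<close>
  have "1 \<bullet> column j Ys = 0" for j
  proof -
    have "column j Ys = column j (A ** Xs) - \<gamma> *\<^sub>R column j (B ** g) - column j Zs"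
      by (simp add: Ys_def column_def vec_eq_iff)
    then have "1 \<bullet> column j Ys = 1 \<bullet> (D *v column j Xs) - \<gamma> * (1 \<bullet> column j g) - 1 \<bullet> column j Zs"
      by (simp add: inner_diff_right column_matrix_mult assms(10) matrix_vector_mul_assoc[symmetric] dotB)
    also have "1 \<bullet> (D *v column j Xs) = xstar $ j * real CARD('m)"
      by (simp add: Xs_def const matrix_vector_mult_scaleR assms(14))
    also have "1 \<bullet> column j Zs = (xstar $ j + \<gamma> * s $ j) * real CARD('m)"
      by (simp add: Zs_def const inner_vec_def)
    also have "1 \<bullet> column j g = - (s $ j * real CARD('m))"
      by (simp add: g_def s_def row_grad_def column_def inner_vec_def)
    finally show ?thesis by (simp add: algebra_simps)
  qed
  from symmetric_matrix_range_columns[OF assms(9,18) this] obtain Ts where Ts: "C ** Ts = Ys" by blast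

  \<comment> \<open>\<open>T\<close> is a running sum of the errors in \<open>Z\<close>. Its start
    is dictated by \<open>Y 0 = 0\<close>, and \<open>CZs\<close> lets the shift by
    \<open>Zs\<close> vanish under \<open>C\<close>.\<close>
  define T where "T = rec_nat ((-1) *\<^sub>R Ts) (\<lambda>k t. t + (Z (Suc k) - Zs))"
  have T: "T 0 = (-1) *\<^sub>R Ts" "T (Suc k) = T k + (Z (Suc k) - Zs)" for k by (simp_all add: T_def)
  have CT: "C ** T k = Y k - Ys" for k
  proof (induction k)
    case 0
    then show ?case by (simp only: T matrix_mult_scaleR Ts assms(23)) simp
  next
    case (Suc k)
    then show ?case by (simp add: T matrix_add_ldistrib matrix_diff_ldistrib CZs assms(26))
  qed

  \<comment> \<open>Error bounds for the proximal and gradient steps\<close>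
  have prox: "norm (X k - Xs) \<le> norm (Z k - Zs)" for k
  proof (rule norm_le_rows)
    fix i
    have "\<forall>i. \<exists>w. subgradient G w ((1 / \<gamma>) *\<^sub>R (Z k $ i - w))"
      using resolvent_exists[OF G sub \<gamma>] by blast
    from choice[OF this]
    obtain w where w: "\<And>i. subgradient G (w i) ((1 / \<gamma>) *\<^sub>R (Z k $ i - w i))" by blast
    have "X k = (\<chi> i. w i)" unfolding assms(24) using w by (intro prox_row_sum_eqI \<gamma>) simp
    then have "subgradient G (X k $ i) ((1 / \<gamma>) *\<^sub>R (Z k $ i - X k $ i))" using w by simp
    moreover have "subgradient G (Xs $ i) ((1 / \<gamma>) *\<^sub>R (Zs $ i - Xs $ i))"
      using sub \<gamma> by (simp add: Xs_def Zs_def)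
    ultimately show "norm ((X k - Xs) $ i) \<le> norm ((Z k - Zs) $ i)"
      using resolvent_nonexpansive[OF \<gamma>] by simp
  qed

  define W where "W k = D ** (X k - Xs) - \<gamma> *\<^sub>R (row_grad f (X k) - g)" for k
  have W: "W k \<bullet> W k \<le> q\<^sup>2 * ((Z k - Zs) \<bullet> (Z k - Zs))" for k
  proof -
    \<comment> \<open>The Frobenius inner product is the sum over rows, so the sector inequalities
      of the individual \<open>f i\<close> add up.\<close>
    have "0 \<le> (row_grad f (X k) - g - \<mu> *\<^sub>R (X k - Xs)) \<bullet> (L *\<^sub>R (X k - Xs) - (row_grad f (X k) - g))"
      by (subst inner_vec_def, intro sum_nonneg) (use gradient_difference_sector[OF sc sm] in \<open>simp add: g_def Xs_def row_grad_def\<close>)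
    then have "norm (W k) \<le> (1 - \<gamma> * \<mu>) * norm (X k - Xs)" unfolding W_def
      using lambda_min_sector[OF assms(11,13)] l \<mu>L \<gamma> step(1) by (intro gradient_step_contraction) auto
    then have "(norm (W k))\<^sup>2 \<le> ((1 - \<gamma> * \<mu>) * norm (X k - Xs))\<^sup>2" by (intro power_mono) auto
    also have "\<dots> \<le> q\<^sup>2 * (norm (Z k - Zs))\<^sup>2"
      unfolding power_mult_distrib
      by (rule mult_mono[OF q power_mono[OF prox norm_ge_zero]]) simp_all
    finally show ?thesis by (simp add: power2_norm_eq_inner)
  qed
  have Z: "Z (Suc k) - Zs = B ** W k - C ** T k" for k
    by (simp add: CT assms(25) W_def Ys_def assms(10) matrix_diff_ldistrib matrix_mult_scaleR matrix_mul_assoc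
        scaleR_diff_right)

  \<comment> \<open>Geometric decay of the energy\<close>
  define V where "V k = (Z k - Zs) \<bullet> (Z k - Zs) + T k \<bullet> (N ** T k)" for k
  have "V (Suc k) \<le> \<delta> * V k" for k
  proof -
    have "V (Suc k) \<le> lm * (W k \<bullet> W k) + (1 - lambda_2 C) * (T k \<bullet> (N ** T k))"
      unfolding V_def T by (rule lyapunov(3)[OF Z])
    also have "\<dots> \<le> lm * (q\<^sup>2 * ((Z k - Zs) \<bullet> (Z k - Zs))) + (1 - lambda_2 C) * (T k \<bullet> (N ** T k))"
      using lyapunov(1) W by (intro add_right_mono mult_left_mono)
    also have "\<dots> = (q\<^sup>2 * lm) * ((Z k - Zs) \<bullet> (Z k - Zs)) + (1 - lambda_2 C) * (T k \<bullet> (N ** T k))"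
      by simp
    also have "\<dots> \<le> \<delta> * ((Z k - Zs) \<bullet> (Z k - Zs)) + \<delta> * (T k \<bullet> (N ** T k))"
      using lyapunov(2) by (intro add_mono mult_right_mono) (simp_all add: \<delta>)
    finally show ?thesis by (simp add: V_def distrib_left)
  qed
  then have decay: "V k \<le> V 0 * \<delta> ^ k" for k
  proof (induction k)
    case (Suc k)
    have "V (Suc k) \<le> \<delta> * V k" by (rule Suc.prems)
    also have "\<dots> \<le> \<delta> * (V 0 * \<delta> ^ k)" using Suc \<delta>0 by (intro mult_left_mono) auto
    finally show ?case by (simp add: mult_ac)
  qed simp
  have "(norm (X k - (\<chi> i. xstar)))\<^sup>2 \<le> V 0 * \<delta> ^ k" for k
  proof -
    have "(norm (X k - Xs))\<^sup>2 \<le> (norm (Z k - Zs))\<^sup>2" using prox by (intro power_mono) auto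
    also have "\<dots> \<le> V k" using lyapunov(2) by (simp add: V_def power2_norm_eq_inner)
    finally show ?thesis using decay[of k] by (simp add: Xs_def)
  qed
  \<comment> \<open>The bound holds from \<open>k = 0\<close> with constant \<open>V 0\<close>;
    nonnegativity of \<open>\<delta>\<close> removes the absolute value in the Landau bound.\<close>
  then show ?thesis using \<delta>0 by (intro bigoI[where c = "V 0"]) (simp add: always_eventually)
qed

end
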